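(* Let $\Omega\subset\mathbb{R}^n$, $n\ge 2$, be a bounded domain, and let $a\in C(\Omega)\cap L^\infty(\Omega)$ with $a(x)>0$ in $\Omega$. Let $S$ be the set of all $\lambda\ge 0$ for which the problem $\Delta_\infty u+\lambda a(x)u^3=0$ in $\Omega$, $u=\delta$ on $\partial\Omega$, has a positive solution $u\in C(\overline{\Omega})$ (where $\delta>0$ is fixed), and let $\lambda_\Omega=\sup S$. Then there is a solution $v\in C(\overline{\Omega})$, $v>0$ in $\Omega$, to the eigenvalue problem $$\Delta_\infty v+\lambda_\Omega a(x)v^3=0\ \text{ in }\Omega,\quad\text{and}\quad v=0\ \text{ on }\partial\Omega.$$
   Context: The infinity-Laplacian is $\Delta_\infty u=\sum_{i,j=1}^n \frac{\partial u}{\partial x_i}\frac{\partial u}{\partial x_j}\frac{\partial^2 u}{\partial x_i\partial x_j}$. Differential equations are understood in the viscosity sense: for $F\in C(\Omega\times\mathbb{R})$, a function $u\in C(\Omega)$ satisfies $\Delta_\infty u\ge F(x,u)$ in $\Omega$ if, whenever $\psi\in C^2(\Omega)$ and $u-\psi$ has a local maximum at $p\in\Omega$, one has $\Delta_\infty\psi(p)\ge F(p,u(p))$; it satisfies $\Delta_\infty u\le F(x,u)$ in $\Omega$ if, whenever $\psi\in C^2(\Omega)$ and $u-\psi$ has a local minimum at $q\in\Omega$, one has $\Delta_\infty\psi(q)\le F(q,u(q))$; $\Delta_\infty u=F(x,u)$ means both. Here $\Delta_\infty u+\lambda a(x)u^3=0$ means $\Delta_\infty u=-\lambda a(x)u^3$.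 The set $S$ does not depend on the choice of $\delta>0$ (by scaling), and it is bounded, so $\lambda_\Omega$ is finite. Boundary conditions are attained pointwise by functions in $C(\overline{\Omega})$. *)

theory Defs
  imports "HOL-Analysis.Analysis"
begin

text \<open>
  A function on a set \<open>\<Omega>\<close> is modelled by a total function on \<open>real ^ 'n\<close>; only its values on \<open>\<Omega>\<close>
  (or on \<open>closure \<Omega>\<close>, where boundary values are involved) matter.
\<close>

definition bounded_domain :: "(real ^ 'n) set \<Rightarrow> bool" where
  "bounded_domain \<Omega> \<longleftrightarrow> open \<Omega> \<and> connected \<Omega> \<and> \<Omega> \<noteq> {} \<and> bounded \<Omega>"

definition L_infinity_on :: "(real ^ 'n) set \<Rightarrow> (real ^ 'n \<Rightarrow> real) \<Rightarrow> bool" where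
  "L_infinity_on \<Omega> a \<longleftrightarrow>
     a \<in> borel_measurable (lebesgue_on \<Omega>) \<and> (\<exists>M. AE x in lebesgue_on \<Omega>. \<bar>a x\<bar> \<le> M)"

definition partial_deriv :: "'n \<Rightarrow> (real ^ 'n \<Rightarrow> real) \<Rightarrow> real ^ 'n \<Rightarrow> real" where
  "partial_deriv i f x = deriv (\<lambda>t. f (x + t *\<^sub>R axis i 1)) 0"

text \<open>
  Twice continuous differentiability on an open set: \<open>g\<close> is the gradient and \<open>H\<close> the Hessian matrix.
\<close>

definition C2_on :: "(real ^ 'n) set \<Rightarrow> (real ^ 'n \<Rightarrow> real) \<Rightarrow> bool" where
  "C2_on \<Omega> f \<longleftrightarrow>
     (\<exists>(g :: real ^ 'n \<Rightarrow> real ^ 'n) (H :: real ^ 'n \<Rightarrow> real ^ 'n ^ 'n).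
        (\<forall>x\<in>\<Omega>. (f has_derivative (\<lambda>h. g x \<bullet> h)) (at x)) \<and>
        (\<forall>x\<in>\<Omega>. (g has_derivative (\<lambda>h. H x *v h)) (at x)) \<and>
        continuous_on \<Omega> H)"

definition inf_laplacian :: "(real ^ 'n \<Rightarrow> real) \<Rightarrow> real ^ 'n \<Rightarrow> real" where
  "inf_laplacian f x =
     (\<Sum>i\<in>UNIV. \<Sum>j\<in>UNIV.
        partial_deriv i f x * partial_deriv j f x * partial_deriv i (partial_deriv j f) x)"

definition has_local_max_in :: "(real ^ 'n) set \<Rightarrow> (real ^ 'n \<Rightarrow> real) \<Rightarrow> real ^ 'n \<Rightarrow> bool" where
  "has_local_max_in \<Omega> f p \<longleftrightarrow> p \<in> \<Omega> \<and> (\<exists>r>0. \<forall>x\<in>\<Omega> \<inter> ball p r. f x \<le> f p)"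

definition has_local_min_in :: "(real ^ 'n) set \<Rightarrow> (real ^ 'n \<Rightarrow> real) \<Rightarrow> real ^ 'n \<Rightarrow> bool" where
  "has_local_min_in \<Omega> f p \<longleftrightarrow> p \<in> \<Omega> \<and> (\<exists>r>0. \<forall>x\<in>\<Omega> \<inter> ball p r. f p \<le> f x)"

text \<open>Viscosity sense of \<open>\<Delta>\<^sub>\<infinity> u \<ge> F(x,u)\<close>, of \<open>\<Delta>\<^sub>\<infinity> u \<le> F(x,u)\<close>, and of equality, in \<open>\<Omega>\<close>.\<close>

definition visc_subsolution ::
    "(real ^ 'n) set \<Rightarrow> (real ^ 'n \<Rightarrow> real \<Rightarrow> real) \<Rightarrow> (real ^ 'n \<Rightarrow> real) \<Rightarrow> bool" where
  "visc_subsolution \<Omega> F u \<longleftrightarrow> continuous_on \<Omega> u \<and>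
     (\<forall>\<psi> p. C2_on \<Omega> \<psi> \<and> has_local_max_in \<Omega> (\<lambda>x. u x - \<psi> x) p \<longrightarrow>
        inf_laplacian \<psi> p \<ge> F p (u p))"

definition visc_supersolution ::
    "(real ^ 'n) set \<Rightarrow> (real ^ 'n \<Rightarrow> real \<Rightarrow> real) \<Rightarrow> (real ^ 'n \<Rightarrow> real) \<Rightarrow> bool" where
  "visc_supersolution \<Omega> F u \<longleftrightarrow> continuous_on \<Omega> u \<and>
     (\<forall>\<psi> q. C2_on \<Omega> \<psi> \<and> has_local_min_in \<Omega> (\<lambda>x. u x - \<psi> x) q \<longrightarrow>
        inf_laplacian \<psi> q \<le> F q (u q))"

definition visc_solution ::
    "(real ^ 'n) set \<Rightarrow> (real ^ 'n \<Rightarrow> real \<Rightarrow> real) \<Rightarrow> (real ^ 'n \<Rightarrow> real) \<Rightarrow> bool" where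
  "visc_solution \<Omega> F u \<longleftrightarrow> visc_subsolution \<Omega> F u \<and> visc_supersolution \<Omega> F u"

text \<open>
  \<open>u \<in> C(closure \<Omega>)\<close> is positive in \<open>\<Omega>\<close>, solves \<open>\<Delta>\<^sub>\<infinity> u + l a(x) u^3 = 0\<close> in \<open>\<Omega>\<close> and equals the constant \<open>c\<close>
  on the boundary.
\<close>

definition positive_solution ::
    "(real ^ 'n) set \<Rightarrow> (real ^ 'n \<Rightarrow> real) \<Rightarrow> real \<Rightarrow> real \<Rightarrow> (real ^ 'n \<Rightarrow> real) \<Rightarrow> bool" where
  "positive_solution \<Omega> a l c u \<longleftrightarrow>
     continuous_on (closure \<Omega>) u \<and>
     (\<forall>x\<in>\<Omega>. u x > 0) \<and>
     visc_solution \<Omega> (\<lambda>x t. - l * a x * t ^ 3) u \<and>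
     (\<forall>x\<in>frontier \<Omega>. u x = c)"

definition solvable_set :: "(real ^ 'n) set \<Rightarrow> (real ^ 'n \<Rightarrow> real) \<Rightarrow> real \<Rightarrow> real set" where
  "solvable_set \<Omega> a \<delta> = {l. l \<ge> 0 \<and> (\<exists>u. positive_solution \<Omega> a l \<delta> u)}"

text \<open>
  The supremum is taken in \<open>real\<close>. It is the genuine one when \<open>solvable_set \<Omega> a \<delta>\<close> is nonempty (it
  contains 0, by constant solutions) and bounded above.
\<close>

definition lambda_sup :: "(real ^ 'n) set \<Rightarrow> (real ^ 'n \<Rightarrow> real) \<Rightarrow> real \<Rightarrow> real" where
  "lambda_sup \<Omega> a \<delta> = Sup (solvable_set \<Omega> a \<delta>)"

end

theory Submission
  imports Defs "HOL-Complex_Analysis.Great_Picard"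
begin

text \<open>
  Put \<open>F\<^sub>l(x,t) = - l a(x) t\<^sup>3\<close> and let \<open>\<Lambda>\<close> be the supremum of the solvable set. The eigenfunction is
  a limit of the solutions \<open>u\<^sub>l\<close> with boundary value \<open>\<delta>\<close>, normalised to have maximum 1, as \<open>l\<close> increases
  to \<open>\<Lambda>\<close>. Every comparison that is needed is with an explicit smooth function, so no comparison
  principle between two viscosity solutions is used. The following observations carry the proof.

  \<^item> Cones. A nonnegative supersolution is infinity-superharmonic, hence it stays above the cone
    with vertex \<open>(y, u(y))\<close> that vanishes on a sphere about \<open>y\<close> (\<open>superharmonic_above_cone\<close>). This single
    inequality gives local Lipschitz bounds and the strong positivity of the limit, and it
    survives infima and pointwise limits.

  \<^item> Perron's method from above. The pointwise infimum \<open>u\<close> of all supersolutions \<open>\<ge> \<delta>\<close> is continuous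
    because of the cones; it is a supersolution by stability, and a subsolution because a strict
    smooth supersolution touching it from above could be pushed below it. Minimality also bounds \<open>u\<close> by
    any explicit barrier. The barrier \<open>\<delta> + (4M/r)(\<rho> - \<rho>\<^sup>2/(4r))\<close>, where \<open>\<rho>\<close> is the distance to a boundary
    point and \<open>M\<close> a bound of \<open>u\<close>, works for a radius \<open>r\<close> depending only on \<open>l sup a\<close>, and in an
    arbitrary domain: it is smooth in \<open>\<Omega>\<close> because the boundary point lies outside.

  \<^item> Bounds for \<open>\<Lambda>\<close>. A concave paraboloid is a supersolution for small \<open>l > 0\<close>, so \<open>\<Lambda> > 0\<close>.
    Touching \<open>u\<close> from below by multiples of \<open>(1 - \<bar>x - y\<bar>\<^sup>2/R\<^sup>2)\<^sup>2\<close> bounds \<open>l\<close> from above, so \<open>\<Lambda>\<close> is finite.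

  \<^item> Blow-up. If \<open>u\<close> solves the problem for \<open>l\<close> and \<open>u \<le> M\<close>, then \<open>2u - \<delta>\<close> is a supersolution for the larger
    value \<open>l (1 + \<delta>/(2M))\<^sup>3\<close>, which is therefore solvable as well (\<open>solvable_set_gain\<close>). So this value is at
    most \<open>\<Lambda>\<close>, and \<open>max u\<^sub>l\<close> tends to infinity as \<open>l\<close> tends to \<open>\<Lambda>\<close>.

  After division by the maximum the boundary values tend to 0, while the cone and barrier estimates
  are uniform up to the boundary. Arzela-Ascoli on the closure of \<open>\<Omega>\<close> yields a uniform limit, which
  solves the equation for \<open>\<Lambda>\<close> by stability, vanishes on the boundary and has maximum 1. By
  connectedness and the cone inequality it is positive in \<open>\<Omega>\<close>.
\<close>

section \<open>Calculus of twice differentiable functions\<close>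

text \<open>
  The gradient and the Hessian are kept as explicit parameters, so that the infinity-Laplacian can be
  computed from them.
\<close>
definition C2_with :: "(real ^ 'n) set \<Rightarrow> (real ^ 'n \<Rightarrow> real) \<Rightarrow> (real ^ 'n \<Rightarrow> real ^ 'n) \<Rightarrow>
    (real ^ 'n \<Rightarrow> real ^ 'n ^ 'n) \<Rightarrow> bool" where
  "C2_with \<Omega> f g H \<longleftrightarrow>
     (\<forall>x\<in>\<Omega>. (f has_derivative (\<lambda>h. g x \<bullet> h)) (at x)) \<and>
     (\<forall>x\<in>\<Omega>. (g has_derivative (\<lambda>h. H x *v h)) (at x)) \<and>
     continuous_on \<Omega> H"

lemma C2_on_iff: "C2_on \<Omega> f \<longleftrightarrow> (\<exists>g H. C2_with \<Omega> f g H)"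
  unfolding C2_on_def C2_with_def by blast

lemma C2_with_imp_C2_on: "C2_with \<Omega> f g H \<Longrightarrow> C2_on \<Omega> f"
  unfolding C2_on_iff by blast

lemma partial_deriv_has_derivative:
  assumes "(f has_derivative (\<lambda>h. g \<bullet> h)) (at x)"
  shows "((\<lambda>t. f (x + t *\<^sub>R axis i 1)) has_real_derivative g $ i) (at 0)"
    and "partial_deriv i f x = g $ i"
proof -
  have 1: "((\<lambda>t. x + t *\<^sub>R axis i 1) has_derivative (\<lambda>t. t *\<^sub>R axis i 1)) (at (0::real))"
    by (auto intro!: derivative_eq_intros)
  have "(f has_derivative (\<lambda>h. g \<bullet> h)) (at (x + 0 *\<^sub>R axis i 1))"
    using assms by simp
  from has_derivative_compose[OF 1 this]
  have "((\<lambda>t. f (x + t *\<^sub>R axis i 1)) has_derivative (\<lambda>t. g \<bullet> (t *\<^sub>R axis i 1))) (at 0)"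
    by simp
  then show *: "((\<lambda>t. f (x + t *\<^sub>R axis i 1)) has_real_derivative g $ i) (at 0)"
    by (simp add: has_field_derivative_def inner_axis mult_commute_abs)
  show "partial_deriv i f x = g $ i"
    unfolding partial_deriv_def using * by (rule DERIV_imp_deriv)
qed

lemma inf_laplacian_eq:
  assumes "open \<Omega>" "x \<in> \<Omega>" and C: "C2_with \<Omega> f g H"
  shows "inf_laplacian f x = g x \<bullet> (H x *v g x)"
proof -
  have p1: "partial_deriv i f y = g y $ i" if "y \<in> \<Omega>" for i y
    using C that partial_deriv_has_derivative(2) unfolding C2_with_def by blast
  have p2: "partial_deriv i (partial_deriv j f) x = H x $ j $ i" for i j
  proof -
    have "(g has_derivative (\<lambda>h. H x *v h)) (at x)"
      using C assms(2) unfolding C2_with_def by blast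
    then have "((\<lambda>y. g y $ j) has_derivative (\<lambda>h. (H x *v h) $ j)) (at x)"
      by (rule bounded_linear.has_derivative[OF bounded_linear_vec_nth])
    moreover have "(\<lambda>h. (H x *v h) $ j) = (\<lambda>h. (H x $ j) \<bullet> h)"
      by (simp add: matrix_vector_mul_component)
    ultimately have "((\<lambda>y. g y $ j) has_derivative (\<lambda>h. (H x $ j) \<bullet> h)) (at x)" by simp
    then have "(partial_deriv j f has_derivative (\<lambda>h. (H x $ j) \<bullet> h)) (at x)"
      using has_derivative_transform_within_open assms p1 by (metis (no_types, lifting))
    then show ?thesis
      using partial_deriv_has_derivative(2) by blast
  qed
  have "g x \<bullet> (H x *v g x) = (\<Sum>j\<in>UNIV. \<Sum>i\<in>UNIV. g x $ i * g x $ j * H x $ j $ i)"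
    by (simp add: inner_vec_def matrix_vector_mult_def sum_distrib_left mult_ac)
  also have "\<dots> = inf_laplacian f x"
    unfolding inf_laplacian_def p2 using p1 assms(2)
    by (subst sum.swap) simp
  finally show ?thesis by simp
qed

lemma C2_on_imp_continuous_on:
  assumes "C2_on \<Omega> f"
  shows "continuous_on \<Omega> f"
  using assms unfolding C2_on_def
  by (meson continuous_at_imp_continuous_on has_derivative_continuous)

lemma continuous_on_inf_laplacian:
  assumes "open \<Omega>" "C2_on \<Omega> f"
  shows "continuous_on \<Omega> (inf_laplacian f)"
proof -
  obtain g H where C: "C2_with \<Omega> f g H" using assms(2) unfolding C2_on_iff by blast
  have g: "continuous_on \<Omega> g"
    using C unfolding C2_with_def by (meson continuous_at_imp_continuous_on has_derivative_continuous)
  have H: "continuous_on \<Omega> H" using C unfolding C2_with_def by blast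
  have "continuous_on \<Omega> (\<lambda>x. g x \<bullet> (H x *v g x))"
    unfolding inner_vec_def matrix_vector_mult_def
    by (auto intro!: continuous_intros g H)
  then show ?thesis
    using inf_laplacian_eq[OF assms(1) _ C] by (metis (no_types, lifting) continuous_on_cong)
qed

lemma C2_with_add:
  assumes "C2_with \<Omega> f g H" "C2_with \<Omega> f' g' H'"
  shows "C2_with \<Omega> (\<lambda>x. f x + f' x) (\<lambda>x. g x + g' x) (\<lambda>x. H x + H' x)"
  using assms unfolding C2_with_def
  by (auto intro!: derivative_eq_intros continuous_intros
      simp: inner_add_left matrix_vector_mult_add_rdistrib)

lemma C2_with_scale:
  assumes "C2_with \<Omega> f g H"
  shows "C2_with \<Omega> (\<lambda>x. c * f x) (\<lambda>x. c *\<^sub>R g x) (\<lambda>x. c *\<^sub>R H x)"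
  using assms unfolding C2_with_def
  by (auto intro!: derivative_eq_intros continuous_intros simp: scaleR_matrix_vector_assoc)

lemma C2_with_const: "C2_with (\<Omega> :: (real ^ 'n) set) (\<lambda>x. c) (\<lambda>x. 0) (\<lambda>x. 0)"
proof -
  have "(\<lambda>h. (0 :: real ^ 'n) \<bullet> h) = (\<lambda>h. 0)" "(\<lambda>h. (0 :: real ^ 'n ^ 'n) *v h) = (\<lambda>h. 0)"
    by (auto simp: fun_eq_iff matrix_vector_mult_def vec_eq_iff)
  note zero_maps = this
  show ?thesis unfolding C2_with_def zero_maps by simp
qed

lemma C2_on_scale: "C2_on \<Omega> f \<Longrightarrow> C2_on \<Omega> (\<lambda>x. c * f x)"
  unfolding C2_on_iff using C2_with_scale by blast

lemma inf_laplacian_scale: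
  assumes "open \<Omega>" "x \<in> \<Omega>" "C2_on \<Omega> f"
  shows "inf_laplacian (\<lambda>x. c * f x) x = c ^ 3 * inf_laplacian f x"
proof -
  obtain g H where C: "C2_with \<Omega> f g H" using assms(3) unfolding C2_on_iff by blast
  show ?thesis
    using inf_laplacian_eq[OF assms(1,2) C] inf_laplacian_eq[OF assms(1,2) C2_with_scale[OF C, of c]]
    by (simp add: matrix_vector_mult_scaleR power3_eq_cube flip: scaleR_matrix_vector_assoc)
qed

text \<open>
  The Hessian of \<open>h (\<bar>x - y\<bar>\<^sup>2)\<close> is a multiple of the identity plus a multiple of the rank-one
  matrix built from \<open>w = x - y\<close>.
\<close>
lemma scalar_plus_rank_one_mult:
  fixes w v :: "real ^ 'n"
  shows "(\<chi> i j. (if i = j then c else 0) + d * w $ i * w $ j) *v v = c *\<^sub>R v + (d * (w \<bullet> v)) *\<^sub>R w"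
    (is "?H *v v = _")
proof -
  have "(?H *v v) $ i = (c *\<^sub>R v + (d * (w \<bullet> v)) *\<^sub>R w) $ i" for i
  proof -
    have "(?H *v v) $ i = (\<Sum>j\<in>UNIV. (if i = j then c * v $ j else 0) + d * w $ i * (w $ j * v $ j))"
      unfolding matrix_vector_mult_def by (auto intro!: sum.cong simp: algebra_simps)
    also have "\<dots> = c * v $ i + d * w $ i * (w \<bullet> v)"
      by (simp add: sum.distrib sum_distrib_left inner_vec_def)
    finally show ?thesis by simp
  qed
  then show ?thesis by (simp add: vec_eq_iff)
qed

text \<open>
  All explicit functions below are radial. Writing them through the squared distance \<open>s\<close> makes
  polynomials in \<open>s\<close> smooth at the centre as well.
\<close>
lemma C2_with_radial:
  fixes y :: "real ^ 'n"
  defines "s \<equiv> \<lambda>x. (x - y) \<bullet> (x - y)"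
  assumes h: "\<And>x. x \<in> \<Omega> \<Longrightarrow> (h has_real_derivative h' (s x)) (at (s x))"
    and h': "\<And>x. x \<in> \<Omega> \<Longrightarrow> (h' has_real_derivative h'' (s x)) (at (s x))"
    and h'': "continuous_on (s ` \<Omega>) h''"
  shows "C2_with \<Omega> (\<lambda>x. h (s x)) (\<lambda>x. (2 * h' (s x)) *\<^sub>R (x - y))
    (\<lambda>x. \<chi> i j. (if i = j then 2 * h' (s x) else 0) + 4 * h'' (s x) * (x - y) $ i * (x - y) $ j)"
    (is "C2_with \<Omega> ?f ?g ?H")
proof -
  have s: "(s has_derivative (\<lambda>v. 2 * ((x - y) \<bullet> v))) (at x)" for x
    unfolding s_def by (auto intro!: derivative_eq_intros simp: inner_commute)
  have fs: "((\<lambda>x. h (s x)) has_derivative (\<lambda>v. h' (s x) * (2 * ((x - y) \<bullet> v)))) (at x)"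
    if "x \<in> \<Omega>" for x
    using has_derivative_compose[OF s h[OF that, unfolded has_field_derivative_def]] by simp
  have h's: "((\<lambda>x. h' (s x)) has_derivative (\<lambda>v. h'' (s x) * (2 * ((x - y) \<bullet> v)))) (at x)"
    if "x \<in> \<Omega>" for x
    using has_derivative_compose[OF s h'[OF that, unfolded has_field_derivative_def]] by simp
  have Hv: "?H x *v v = (2 * h' (s x)) *\<^sub>R v + (4 * h'' (s x) * ((x - y) \<bullet> v)) *\<^sub>R (x - y)" for x v
    by (rule scalar_plus_rank_one_mult)
  have cs: "continuous_on \<Omega> s" unfolding s_def by (intro continuous_intros)
  have ch': "continuous_on \<Omega> (\<lambda>x. h' (s x))"
    using h's by (meson continuous_at_imp_continuous_on has_derivative_continuous)
  have ch'': "continuous_on \<Omega> (\<lambda>x. h'' (s x))"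
    using continuous_on_compose[OF cs h''] by (simp add: o_def)
  have cH: "continuous_on \<Omega> ?H"
  proof (intro continuous_on_vec_lambda)
    fix i j
    show "continuous_on \<Omega> (\<lambda>x. (if i = j then 2 * h' (s x) else 0) + 4 * h'' (s x) * (x - y) $ i * (x - y) $ j)"
      by (cases "i = j") (auto intro!: continuous_intros ch' ch'')
  qed
  have df: "(?f has_derivative (\<lambda>v. ?g x \<bullet> v)) (at x)" if "x \<in> \<Omega>" for x
    using fs[OF that] by (simp add: mult_ac)
  have dg: "(?g has_derivative (\<lambda>v. ?H x *v v)) (at x)" if "x \<in> \<Omega>" for x
    unfolding Hv
    by (rule derivative_eq_intros h's[OF that] refl)+ (auto simp: algebra_simps)
  show ?thesis unfolding C2_with_def using df dg cH by blast
qed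

text \<open>
  With \<open>\<rho> = \<surd>s\<close> and \<open>f(\<rho>) = h(\<rho>\<^sup>2)\<close> the value below is \<open>f'(\<rho>)\<^sup>2 f''(\<rho>)\<close>: only the radial second derivative
  enters.
\<close>
lemma inf_laplacian_radial:
  fixes y :: "real ^ 'n"
  defines "s \<equiv> \<lambda>x. (x - y) \<bullet> (x - y)"
  assumes "open \<Omega>"
    and h: "\<And>x. x \<in> \<Omega> \<Longrightarrow> (h has_real_derivative h' (s x)) (at (s x))"
    and h': "\<And>x. x \<in> \<Omega> \<Longrightarrow> (h' has_real_derivative h'' (s x)) (at (s x))"
    and h'': "continuous_on (s ` \<Omega>) h''"
  shows "C2_on \<Omega> (\<lambda>x. h (s x))"
    and "x \<in> \<Omega> \<Longrightarrow> inf_laplacian (\<lambda>x. h (s x)) x = 8 * s x * (h' (s x))\<^sup>2 * (h' (s x) + 2 * s x * h'' (s x))"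
proof -
  have C: "C2_with \<Omega> (\<lambda>x. h (s x)) (\<lambda>x. (2 * h' (s x)) *\<^sub>R (x - y))
    (\<lambda>x. \<chi> i j. (if i = j then 2 * h' (s x) else 0) + 4 * h'' (s x) * (x - y) $ i * (x - y) $ j)"
    unfolding s_def by (rule C2_with_radial) (use h h' h'' in \<open>simp_all add: s_def\<close>)
  show "C2_on \<Omega> (\<lambda>x. h (s x))" using C2_with_imp_C2_on[OF C] .
  assume x: "x \<in> \<Omega>"
  let ?H = "\<chi> i j. (if i = j then 2 * h' (s x) else 0) + 4 * h'' (s x) * (x - y) $ i * (x - y) $ j"
  let ?d = "x - y"
  have Hv: "?H *v ?d = (2 * h' (s x) + 4 * h'' (s x) * s x) *\<^sub>R ?d"
    unfolding scalar_plus_rank_one_mult s_def by (simp add: scaleR_add_left)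
  have "inf_laplacian (\<lambda>x. h (s x)) x
      = ((2 * h' (s x)) *\<^sub>R ?d) \<bullet> (?H *v ((2 * h' (s x)) *\<^sub>R ?d))"
    using inf_laplacian_eq[OF assms(2) x C] by simp
  also have "\<dots> = (2 * h' (s x)) * (2 * h' (s x)) * (2 * h' (s x) + 4 * h'' (s x) * s x) * s x"
    by (simp only: matrix_vector_mult_scaleR Hv) (simp add: s_def)
  finally show "inf_laplacian (\<lambda>x. h (s x)) x = 8 * s x * (h' (s x))\<^sup>2 * (h' (s x) + 2 * s x * h'' (s x))"
    by (simp add: power2_eq_square algebra_simps)
qed

section \<open>Test functions and stability of viscosity supersolutions\<close>

text \<open>
  First and second order necessary conditions, by restricting \<open>f\<close> to lines through \<open>q\<close>.
\<close>
lemma local_min_first_second_order: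
  assumes "open \<Omega>" and C: "C2_with \<Omega> f g H" and m: "has_local_min_in \<Omega> f q"
  shows "g q = 0" and "0 \<le> v \<bullet> (H q *v v)"
proof -
  from m obtain r where r: "r > 0" "\<And>x. x \<in> \<Omega> \<inter> ball q r \<Longrightarrow> f q \<le> f x" and q: "q \<in> \<Omega>"
    unfolding has_local_min_in_def by blast
  have "open (\<Omega> \<inter> ball q r)" "q \<in> \<Omega> \<inter> ball q r" using assms(1) q r by auto
  then obtain r' where r': "r' > 0" "cball q r' \<subseteq> \<Omega> \<inter> ball q r"
    using open_contains_cball by blast
  have line: "\<exists>d>0. (\<forall>t. \<bar>t\<bar> < d \<longrightarrow> ((\<lambda>t. f (q + t *\<^sub>R v)) has_real_derivative g (q + t *\<^sub>R v) \<bullet> v) (at t)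
                     \<and> f q \<le> f (q + t *\<^sub>R v))" for v
  proof (intro exI conjI allI impI)
    show "r' / (norm v + 1) > 0" using r' by (simp add: add_nonneg_pos)
    fix t :: real assume "\<bar>t\<bar> < r' / (norm v + 1)"
    then have "\<bar>t\<bar> * (norm v + 1) < r'"
      by (simp add: pos_less_divide_eq add_nonneg_pos)
    then have "\<bar>t\<bar> * norm v \<le> r'" by (simp add: algebra_simps)
    then have "q + t *\<^sub>R v \<in> cball q r'" by (simp add: dist_norm)
    then have in\<Omega>: "q + t *\<^sub>R v \<in> \<Omega> \<inter> ball q r" using r' by blast
    then show "f q \<le> f (q + t *\<^sub>R v)" using r by blast
    have df: "(f has_derivative (\<lambda>h. g (q + t *\<^sub>R v) \<bullet> h)) (at (q + t *\<^sub>R v))"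
      using C in\<Omega> unfolding C2_with_def by blast
    have dl: "((\<lambda>t. q + t *\<^sub>R v) has_derivative (\<lambda>t. t *\<^sub>R v)) (at t)"
      by (auto intro!: derivative_eq_intros)
    show "((\<lambda>t. f (q + t *\<^sub>R v)) has_real_derivative g (q + t *\<^sub>R v) \<bullet> v) (at t)"
      using has_derivative_compose[OF dl df] by (simp add: has_field_derivative_def mult_commute_abs)
  qed
  have gv: "g q \<bullet> v = 0" for v
  proof -
    obtain d where d: "d > 0"
      "\<And>t. \<bar>t\<bar> < d \<Longrightarrow> ((\<lambda>t. f (q + t *\<^sub>R v)) has_real_derivative g (q + t *\<^sub>R v) \<bullet> v) (at t)"
      "\<And>t. \<bar>t\<bar> < d \<Longrightarrow> f q \<le> f (q + t *\<^sub>R v)" using line by metis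
    show ?thesis
      using DERIV_local_min[OF d(2)[of 0] d(1)] d by simp
  qed
  then show g0: "g q = 0" by (metis inner_eq_zero_iff)
  show "0 \<le> v \<bullet> (H q *v v)"
  proof (rule ccontr)
    assume neg: "\<not> ?thesis"
    obtain d where d: "d > 0"
      "\<And>t. \<bar>t\<bar> < d \<Longrightarrow> ((\<lambda>t. f (q + t *\<^sub>R v)) has_real_derivative g (q + t *\<^sub>R v) \<bullet> v) (at t)"
      "\<And>t. \<bar>t\<bar> < d \<Longrightarrow> f q \<le> f (q + t *\<^sub>R v)" using line by metis
    have dg: "(g has_derivative (\<lambda>h. H q *v h)) (at (q + 0 *\<^sub>R v))"
      using C q unfolding C2_with_def by simp
    have dl: "((\<lambda>t. q + t *\<^sub>R v) has_derivative (\<lambda>t. t *\<^sub>R v)) (at (0::real))"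
      by (auto intro!: derivative_eq_intros)
    have "((\<lambda>t. g (q + t *\<^sub>R v) \<bullet> v) has_derivative (\<lambda>s. (H q *v (s *\<^sub>R v)) \<bullet> v)) (at 0)"
      using has_derivative_inner_left[OF has_derivative_compose[OF dl dg]] by simp
    then have "((\<lambda>t. g (q + t *\<^sub>R v) \<bullet> v) has_real_derivative (H q *v v) \<bullet> v) (at 0)"
      by (simp add: has_field_derivative_def mult_commute_abs matrix_vector_mult_scaleR)
    from DERIV_neg_dec_right[OF this] neg obtain e where
      e: "e > 0" "\<And>h. h > 0 \<Longrightarrow> h < e \<Longrightarrow> g (q + h *\<^sub>R v) \<bullet> v < 0"
      using g0 by (auto simp: inner_commute)
    define t where "t = min d e / 2"
    have t: "t > 0" "t < d" "t < e" using d(1) e(1) by (auto simp: t_def min_def)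
    obtain z where z: "z > 0" "z < t"
      "f (q + t *\<^sub>R v) - f (q + 0 *\<^sub>R v) = (t - 0) * (g (q + z *\<^sub>R v) \<bullet> v)"
      using MVT2[of 0 t "\<lambda>t. f (q + t *\<^sub>R v)" "\<lambda>t. g (q + t *\<^sub>R v) \<bullet> v"] t d(2) by auto
    have "(t - 0) * (g (q + z *\<^sub>R v) \<bullet> v) < 0"
      using e(2)[of z] z t by (simp add: mult_pos_neg)
    then show False using z d(3)[of t] t by auto
  qed
qed

text \<open>
  At a local minimum of \<open>w - \<psi>\<close> the gradients agree and the Hessian of \<open>w\<close> dominates in the direction of
  the gradient.
\<close>
lemma inf_laplacian_mono_at_local_min:
  assumes "open \<Omega>" "C2_on \<Omega> w" "C2_on \<Omega> \<psi>"
    and m: "has_local_min_in \<Omega> (\<lambda>x. w x - \<psi> x) q"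
  shows "inf_laplacian \<psi> q \<le> inf_laplacian w q"
proof -
  obtain g H where w: "C2_with \<Omega> w g H" using assms unfolding C2_on_iff by blast
  obtain g' H' where p: "C2_with \<Omega> \<psi> g' H'" using assms unfolding C2_on_iff by blast
  have q: "q \<in> \<Omega>" using m unfolding has_local_min_in_def by blast
  have "C2_with \<Omega> (\<lambda>x. w x + (-1) * \<psi> x) (\<lambda>x. g x + (-1) *\<^sub>R g' x) (\<lambda>x. H x + (-1) *\<^sub>R H' x)"
    by (intro C2_with_add C2_with_scale w p)
  then have C: "C2_with \<Omega> (\<lambda>x. w x - \<psi> x) (\<lambda>x. g x - g' x) (\<lambda>x. H x - H' x)"
    by simp
  from local_min_first_second_order[OF assms(1) C m] have g: "g q = g' q"
    and "0 \<le> g q \<bullet> ((H q - H' q) *v g q)" by auto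
  then show ?thesis
    using inf_laplacian_eq[OF assms(1) q] w p
    by (simp add: matrix_vector_mult_diff_rdistrib inner_diff_right)
qed

text \<open>
  Adding a multiple of \<open>\<bar>x - q\<bar>\<^sup>4\<close> of the right sign turns local extrema at \<open>q\<close> into strict ones without changing the second
  order data at \<open>q\<close>.
\<close>
lemma quartic_perturbation:
  fixes c k :: real
  assumes "open \<Omega>" "C2_on \<Omega> \<psi>" "q \<in> \<Omega>"
  defines "\<phi> \<equiv> \<lambda>x. \<psi> x + c * ((x - q) \<bullet> (x - q))\<^sup>2 + k"
  shows "C2_on \<Omega> \<phi>" and "inf_laplacian \<phi> q = inf_laplacian \<psi> q"
proof -
  obtain g H where p: "C2_with \<Omega> \<psi> g H" using assms unfolding C2_on_iff by blast
  define g' where "g' = (\<lambda>x. (2 * (2 * ((x - q) \<bullet> (x - q)))) *\<^sub>R (x - q))"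
  define H' where "H' = (\<lambda>x. \<chi> i j. (if i = j then 2 * (2 * ((x - q) \<bullet> (x - q))) else 0)
      + 4 * 2 * (x - q) $ i * (x - q) $ j)"
  have r: "C2_with \<Omega> (\<lambda>x. ((x - q) \<bullet> (x - q))\<^sup>2) g' H'"
    unfolding g'_def H'_def
    by (rule C2_with_radial[where h = "\<lambda>s. s\<^sup>2" and h' = "\<lambda>s. 2 * s" and h'' = "\<lambda>s. 2"])
       (auto intro!: derivative_eq_intros)
  have C: "C2_with \<Omega> \<phi> (\<lambda>x. g x + c *\<^sub>R g' x + 0) (\<lambda>x. H x + c *\<^sub>R H' x + 0)"
    unfolding \<phi>_def by (intro C2_with_add C2_with_scale C2_with_const p r)
  show "C2_on \<Omega> \<phi>" using C by (rule C2_with_imp_C2_on)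
  have "g' q = 0" "H' q = 0" unfolding g'_def H'_def by (auto simp: vec_eq_iff)
  then show "inf_laplacian \<phi> q = inf_laplacian \<psi> q"
    using inf_laplacian_eq[OF assms(1) assms(3) C] inf_laplacian_eq[OF assms(1) assms(3) p] by simp
qed

lemma inf_laplacian_add_const:
  assumes "open \<Omega>" "C2_on \<Omega> \<psi>" "q \<in> \<Omega>"
  shows "C2_on \<Omega> (\<lambda>x. \<psi> x + k)" and "inf_laplacian (\<lambda>x. \<psi> x + k) q = inf_laplacian \<psi> q"
  using quartic_perturbation[OF assms, of 0 k] by auto

lemma classical_imp_visc_supersolution:
  assumes "open \<Omega>" "C2_on \<Omega> w" "\<And>x. x \<in> \<Omega> \<Longrightarrow> inf_laplacian w x \<le> F x (w x)"
  shows "visc_supersolution \<Omega> F w"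
  unfolding visc_supersolution_def
proof (intro conjI allI impI)
  show "continuous_on \<Omega> w" by (rule C2_on_imp_continuous_on) fact
  fix \<psi> q assume "C2_on \<Omega> \<psi> \<and> has_local_min_in \<Omega> (\<lambda>x. w x - \<psi> x) q"
  then show "inf_laplacian \<psi> q \<le> F q (w q)"
    using inf_laplacian_mono_at_local_min[of \<Omega> w \<psi> q] assms
    by (meson has_local_min_in_def order_trans)
qed

lemma inf_laplacian_const: "inf_laplacian (\<lambda>x. c) x = 0"
  unfolding inf_laplacian_def partial_deriv_def by simp

lemma C2_on_const: "C2_on \<Omega> (\<lambda>x. c)"
  using C2_with_const C2_on_iff by blast

text \<open>
  The minimum of two supersolutions is one. Here the second one is smooth and lives only on \<open>U\<close>; off the
  smaller closed set \<open>C\<close> it lies above \<open>u\<close>, so the two definitions fit together continuously.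
\<close>
lemma visc_supersolution_glue:
  assumes "open \<Omega>" "open U" "closed C" "C \<subseteq> U"
    and u: "visc_supersolution \<Omega> F u"
    and \<phi>: "C2_on \<Omega> \<phi>" "\<And>x. x \<in> \<Omega> \<inter> U \<Longrightarrow> inf_laplacian \<phi> x \<le> F x (\<phi> x)"
    and above: "\<And>x. x \<in> \<Omega> \<inter> U - C \<Longrightarrow> u x \<le> \<phi> x"
  shows "visc_supersolution \<Omega> F (\<lambda>x. if x \<in> U then min (u x) (\<phi> x) else u x)"
    (is "visc_supersolution \<Omega> F ?w")
  unfolding visc_supersolution_def
proof (intro conjI allI impI)
  have cu: "continuous_on \<Omega> u" using u unfolding visc_supersolution_def by blast
  have c\<phi>: "continuous_on \<Omega> \<phi>" by (rule C2_on_imp_continuous_on) fact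
  have "continuous_on ((\<Omega> \<inter> U) \<union> (\<Omega> - C)) ?w"
  proof (rule continuous_on_open_Un)
    show "open (\<Omega> \<inter> U)" "open (\<Omega> - C)" using assms by (auto intro: open_Diff)
    have "continuous_on (\<Omega> \<inter> U) (\<lambda>x. min (u x) (\<phi> x))"
      by (intro continuous_intros continuous_on_subset[OF cu] continuous_on_subset[OF c\<phi>]) auto
    then show "continuous_on (\<Omega> \<inter> U) ?w" by (rule continuous_on_eq) auto
    have "continuous_on (\<Omega> - C) u" by (rule continuous_on_subset[OF cu]) auto
    then show "continuous_on (\<Omega> - C) ?w" by (rule continuous_on_eq) (use above in auto)
  qed
  moreover have "(\<Omega> \<inter> U) \<union> (\<Omega> - C) = \<Omega>" using assms(4) by blast
  ultimately show "continuous_on \<Omega> ?w" by simp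
  fix \<psi> q assume "C2_on \<Omega> \<psi> \<and> has_local_min_in \<Omega> (\<lambda>x. ?w x - \<psi> x) q"
  then have \<psi>: "C2_on \<Omega> \<psi>" and m: "has_local_min_in \<Omega> (\<lambda>x. ?w x - \<psi> x) q" by auto
  from m obtain r where q: "q \<in> \<Omega>" and r: "r > 0"
    "\<And>x. x \<in> \<Omega> \<inter> ball q r \<Longrightarrow> ?w q - \<psi> q \<le> ?w x - \<psi> x"
    unfolding has_local_min_in_def by blast
  show "inf_laplacian \<psi> q \<le> F q (?w q)"
  proof (cases "?w q = u q")
    case True
    have "u q - \<psi> q \<le> u x - \<psi> x" if "x \<in> \<Omega> \<inter> ball q r" for x
    proof -
      have "?w x \<le> u x" by auto
      then show ?thesis using r(2)[OF that] unfolding True by linarith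
    qed
    then have "has_local_min_in \<Omega> (\<lambda>x. u x - \<psi> x) q"
      unfolding has_local_min_in_def using q r by blast
    then show ?thesis using u \<psi> unfolding True visc_supersolution_def by blast
  next
    case False
    then have qU: "q \<in> U" and wq: "?w q = \<phi> q" by (auto split: if_splits simp: min_def)
    from qU obtain r' where r': "r' > 0" "ball q r' \<subseteq> U" using assms(2) open_contains_ball by blast
    have "has_local_min_in \<Omega> (\<lambda>x. \<phi> x - \<psi> x) q"
      unfolding has_local_min_in_def
    proof (intro conjI exI[of _ "min r r'"] ballI)
      fix x assume x: "x \<in> \<Omega> \<inter> ball q (min r r')"
      then have "x \<in> U" using r' by auto
      then have "?w x \<le> \<phi> x" by simp
      then show "\<phi> q - \<psi> q \<le> \<phi> x - \<psi> x" using r(2)[of x] x unfolding wq by simp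
    qed (use q r r' in auto)
    from inf_laplacian_mono_at_local_min[OF assms(1) \<phi>(1) \<psi> this]
    show ?thesis unfolding wq using \<phi>(2)[of q] q qU by simp
  qed
qed

abbreviation (input) eigen_rhs :: "(real ^ 'n \<Rightarrow> real) \<Rightarrow> real \<Rightarrow> real ^ 'n \<Rightarrow> real \<Rightarrow> real" where
  "eigen_rhs a l \<equiv> (\<lambda>x t. - l * a x * t ^ 3)"

lemma visc_supersolutionD:
  "visc_supersolution \<Omega> F u \<Longrightarrow> C2_on \<Omega> \<psi> \<Longrightarrow> has_local_min_in \<Omega> (\<lambda>x. u x - \<psi> x) q
    \<Longrightarrow> inf_laplacian \<psi> q \<le> F q (u q)"
  unfolding visc_supersolution_def by blast

text \<open>
  Both the infinity-Laplacian and the right-hand side are odd (of degree 3), so every statement on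
  supersolutions transfers to subsolutions by a change of sign.
\<close>
lemma visc_subsolution_uminus_iff:
  assumes "open \<Omega>"
  shows "visc_subsolution \<Omega> (eigen_rhs a l) u \<longleftrightarrow> visc_supersolution \<Omega> (eigen_rhs a l) (\<lambda>x. - u x)"
proof -
  have neg: "C2_on \<Omega> (\<lambda>x. - \<psi> x)" "x \<in> \<Omega> \<Longrightarrow> inf_laplacian (\<lambda>x. - \<psi> x) x = - inf_laplacian \<psi> x"
    if "C2_on \<Omega> \<psi>" for \<psi> x
    using C2_on_scale[OF that, of "-1"] inf_laplacian_scale[OF assms _ that, of x "-1"] by auto
  have mm: "has_local_max_in \<Omega> (\<lambda>x. u x - \<psi> x) p \<longleftrightarrow> has_local_min_in \<Omega> (\<lambda>x. - u x - - \<psi> x) p" for \<psi> p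
    unfolding has_local_max_in_def has_local_min_in_def by (simp add: algebra_simps)
  have in\<Omega>: "has_local_min_in \<Omega> f p \<Longrightarrow> p \<in> \<Omega>" for f p
    unfolding has_local_min_in_def by blast
  have c: "continuous_on \<Omega> u \<longleftrightarrow> continuous_on \<Omega> (\<lambda>x. - u x)"
    using continuous_on_minus[of \<Omega> u] continuous_on_minus[of \<Omega> "\<lambda>x. - u x"] by auto
  have "(\<forall>\<psi> p. C2_on \<Omega> \<psi> \<and> has_local_max_in \<Omega> (\<lambda>x. u x - \<psi> x) p \<longrightarrow> - l * a p * u p ^ 3 \<le> inf_laplacian \<psi> p)
    \<longleftrightarrow> (\<forall>\<psi> p. C2_on \<Omega> \<psi> \<and> has_local_min_in \<Omega> (\<lambda>x. - u x - \<psi> x) p \<longrightarrow> inf_laplacian \<psi> p \<le> - l * a p * (- u p) ^ 3)"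
    (is "?L \<longleftrightarrow> ?R")
  proof
    assume L: ?L
    show ?R
    proof (intro allI impI, elim conjE)
      fix \<psi> p assume h: "C2_on \<Omega> \<psi>" "has_local_min_in \<Omega> (\<lambda>x. - u x - \<psi> x) p"
      have "has_local_max_in \<Omega> (\<lambda>x. u x - - \<psi> x) p" unfolding mm using h by simp
      with L neg(1)[OF h(1)] have "- l * a p * u p ^ 3 \<le> inf_laplacian (\<lambda>x. - \<psi> x) p" by blast
      then show "inf_laplacian \<psi> p \<le> - l * a p * (- u p) ^ 3"
        using neg(2)[OF h(1) in\<Omega>[OF h(2)]] by simp
    qed
  next
    assume R: ?R
    show ?L
    proof (intro allI impI, elim conjE)
      fix \<psi> p assume h: "C2_on \<Omega> \<psi>" "has_local_max_in \<Omega> (\<lambda>x. u x - \<psi> x) p"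
      have h': "has_local_min_in \<Omega> (\<lambda>x. - u x - - \<psi> x) p" using h(2) unfolding mm .
      with R neg(1)[OF h(1)] have "inf_laplacian (\<lambda>x. - \<psi> x) p \<le> - l * a p * (- u p) ^ 3" by blast
      then show "- l * a p * u p ^ 3 \<le> inf_laplacian \<psi> p"
        using neg(2)[OF h(1) in\<Omega>[OF h']] by simp
    qed
  qed
  then show ?thesis unfolding visc_subsolution_def visc_supersolution_def c by blast
qed

text \<open>
  Two uses: positive multiples of solutions are solutions (\<open>l' = l\<close>, \<open>d = 0\<close>), and subtracting a constant
  allows the parameter \<open>l\<close> to be increased (\<open>d < 0\<close>).
\<close>
lemma visc_supersolution_affine:
  assumes "open \<Omega>" "t > 0" and u: "visc_supersolution \<Omega> (eigen_rhs a l) u"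
    and le: "\<And>x. x \<in> \<Omega> \<Longrightarrow> l' * a x * (t * u x + d) ^ 3 \<le> l * a x * (t * u x) ^ 3"
  shows "visc_supersolution \<Omega> (eigen_rhs a l') (\<lambda>x. t * u x + d)"
  unfolding visc_supersolution_def
proof (intro conjI allI impI)
  show "continuous_on \<Omega> (\<lambda>x. t * u x + d)"
    using u unfolding visc_supersolution_def by (auto intro!: continuous_intros)
  fix \<psi> q assume "C2_on \<Omega> \<psi> \<and> has_local_min_in \<Omega> (\<lambda>x. t * u x + d - \<psi> x) q"
  then have \<psi>: "C2_on \<Omega> \<psi>" and m: "has_local_min_in \<Omega> (\<lambda>x. t * u x + d - \<psi> x) q" by auto
  then have q: "q \<in> \<Omega>" unfolding has_local_min_in_def by blast
  have "u q - (1 / t) * \<psi> q \<le> u x - (1 / t) * \<psi> x"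
    if "t * u q + d - \<psi> q \<le> t * u x + d - \<psi> x" for x
  proof -
    have "t * (u q - (1 / t) * \<psi> q) \<le> t * (u x - (1 / t) * \<psi> x)"
      using that assms(2) by (simp add: right_diff_distrib)
    then show ?thesis using assms(2) by simp
  qed
  then have "has_local_min_in \<Omega> (\<lambda>x. u x - (1 / t) * \<psi> x) q"
    using m unfolding has_local_min_in_def by blast
  from visc_supersolutionD[OF u C2_on_scale[OF \<psi>] this]
  have "(1 / t) ^ 3 * inf_laplacian \<psi> q \<le> - l * a q * u q ^ 3"
    unfolding inf_laplacian_scale[OF assms(1) q \<psi>] .
  then have "t ^ 3 * ((1 / t) ^ 3 * inf_laplacian \<psi> q) \<le> t ^ 3 * (- l * a q * u q ^ 3)"
    using assms(2) by (intro mult_left_mono) auto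
  then have "inf_laplacian \<psi> q \<le> - (l * a q * (t * u q) ^ 3)"
    using assms(2) by (simp add: power_divide power_mult_distrib algebra_simps)
  then show "inf_laplacian \<psi> q \<le> - l' * a q * (t * u q + d) ^ 3"
    using le[OF q] by simp
qed

text \<open>
  Stability under one-sided approximation: near \<open>q\<close> the approximating supersolutions need not converge,
  they only have to stay almost above \<open>u\<close> and to be almost as small as \<open>u\<close> at \<open>q\<close>. This covers both the
  infimum in Perron's method and uniform limits with varying \<open>l\<close>. The quartic
  perturbation forces the minimum points of the approximations to converge to \<open>q\<close>.
\<close>
lemma visc_supersolution_limit:
  assumes \<Omega>: "open \<Omega>" and a: "continuous_on \<Omega> a" and u: "continuous_on \<Omega> u"
    and approx: "\<And>q e. q \<in> \<Omega> \<Longrightarrow> e > 0 \<Longrightarrow> \<exists>l' w. \<bar>l' - l\<bar> \<le> e \<and> visc_supersolution \<Omega> (eigen_rhs a l') w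
                    \<and> w q \<le> u q + e \<and> (\<forall>x\<in>\<Omega>. u x - e \<le> w x)"
  shows "visc_supersolution \<Omega> (eigen_rhs a l) u"
  unfolding visc_supersolution_def
proof (intro conjI allI impI)
  show "continuous_on \<Omega> u" by fact
  fix \<psi> q assume "C2_on \<Omega> \<psi> \<and> has_local_min_in \<Omega> (\<lambda>x. u x - \<psi> x) q"
  then have \<psi>: "C2_on \<Omega> \<psi>" and m: "has_local_min_in \<Omega> (\<lambda>x. u x - \<psi> x) q" by auto
  from m obtain r where q: "q \<in> \<Omega>" and r: "r > 0"
    "\<And>x. x \<in> \<Omega> \<inter> ball q r \<Longrightarrow> u q - \<psi> q \<le> u x - \<psi> x"
    unfolding has_local_min_in_def by blast
  have "open (\<Omega> \<inter> ball q r)" "q \<in> \<Omega> \<inter> ball q r" using \<Omega> q r by auto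
  then obtain R where R: "R > 0" "cball q R \<subseteq> \<Omega> \<inter> ball q r"
    using open_contains_cball by blast
  define \<phi> where "\<phi> = (\<lambda>x. \<psi> x + (-1) * ((x - q) \<bullet> (x - q))\<^sup>2 + 0)"
  note \<phi> = quartic_perturbation[OF \<Omega> \<psi> q, of "-1" 0, folded \<phi>_def]
  have c\<phi>: "continuous_on \<Omega> \<phi>" by (rule C2_on_imp_continuous_on[OF \<phi>(1)])
  have c\<psi>: "continuous_on \<Omega> \<psi>" by (rule C2_on_imp_continuous_on[OF \<psi>])
  define e where "e = (\<lambda>n. inverse (real (Suc n)))"
  have e: "e n > 0" for n by (simp add: e_def)
  have e0: "e \<longlonglongrightarrow> 0" unfolding e_def by (rule LIMSEQ_inverse_real_of_nat)
  have "\<exists>l' w. \<bar>l' - l\<bar> \<le> e n \<and> visc_supersolution \<Omega> (eigen_rhs a l') w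
                    \<and> w q \<le> u q + e n \<and> (\<forall>x\<in>\<Omega>. u x - e n \<le> w x)" for n
    using approx[OF q e] .
  then obtain l' w where w: "\<And>n. \<bar>l' n - l\<bar> \<le> e n" "\<And>n. visc_supersolution \<Omega> (eigen_rhs a (l' n)) (w n)"
    "\<And>n. w n q \<le> u q + e n" "\<And>n x. x \<in> \<Omega> \<Longrightarrow> u x - e n \<le> w n x"
    by metis
  have "\<exists>y\<in>cball q R. \<forall>x\<in>cball q R. w n y - \<phi> y \<le> w n x - \<phi> x" for n
  proof (rule continuous_attains_inf)
    have "continuous_on \<Omega> (w n)" using w(2) unfolding visc_supersolution_def by blast
    then show "continuous_on (cball q R) (\<lambda>x. w n x - \<phi> x)"
      using R c\<phi> by (intro continuous_on_diff) (auto intro: continuous_on_subset)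
  qed (use R in auto)
  then obtain p where p: "\<And>n. p n \<in> cball q R" "\<And>n x. x \<in> cball q R \<Longrightarrow> w n (p n) - \<phi> (p n) \<le> w n x - \<phi> x"
    by metis
  have p\<Omega>: "p n \<in> \<Omega>" for n using p R by blast
  let ?d = "\<lambda>n. ((p n - q) \<bullet> (p n - q))\<^sup>2"
  \<comment> \<open>Compare the minimal value at \<open>p n\<close> with the value at \<open>q\<close>.\<close>
  have key: "w n (p n) - \<psi> (p n) + ?d n \<le> u q + e n - \<psi> q" for n
    using p(2)[of q n] w(3)[of n] R unfolding \<phi>_def by simp
  have um: "u q - \<psi> q \<le> u (p n) - \<psi> (p n)" for n
    using r(2)[of "p n"] p(1)[of n] R by blast
  have d: "?d n \<le> 2 * e n" for n
    using key[of n] um[of n] w(4)[OF p\<Omega>, of n n] by linarith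
  have "?d \<longlonglongrightarrow> 0"
  proof (rule tendsto_sandwich[of "\<lambda>n. 0" _ _ "\<lambda>n. 2 * e n"])
    show "(\<lambda>n. 2 * e n) \<longlonglongrightarrow> 0" using tendsto_mult_left[OF e0, of 2] by simp
  qed (use d in auto)
  then have "(\<lambda>n. sqrt (sqrt (?d n))) \<longlonglongrightarrow> sqrt (sqrt 0)"
    by (intro tendsto_real_sqrt)
  then have "(\<lambda>n. norm (p n - q)) \<longlonglongrightarrow> 0"
    by (simp add: norm_eq_sqrt_inner)
  then have pq: "p \<longlonglongrightarrow> q"
    using tendsto_norm_zero_iff LIM_zero_iff by blast
  have lim: "(\<lambda>n. f (p n)) \<longlonglongrightarrow> f q" if "continuous_on \<Omega> f" for f :: "_ \<Rightarrow> real"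
    using continuous_on_tendsto_compose[OF that pq q] p\<Omega> by simp
  have wl: "(\<lambda>n. w n (p n)) \<longlonglongrightarrow> u q"
  proof (rule tendsto_sandwich)
    show "\<forall>\<^sub>F n in sequentially. u (p n) - e n \<le> w n (p n)" using w(4) p\<Omega> by simp
    have "w n (p n) \<le> u q + e n - \<psi> q + \<psi> (p n)" for n
      using key[of n] zero_le_power2[of "(p n - q) \<bullet> (p n - q)"] by linarith
    then show "\<forall>\<^sub>F n in sequentially. w n (p n) \<le> u q + e n - \<psi> q + \<psi> (p n)" by simp
    show "(\<lambda>n. u (p n) - e n) \<longlonglongrightarrow> u q"
      using tendsto_diff[OF lim[OF u] e0] by simp
    show "(\<lambda>n. u q + e n - \<psi> q + \<psi> (p n)) \<longlonglongrightarrow> u q"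
      using tendsto_add[OF tendsto_diff[OF tendsto_add[OF tendsto_const e0] tendsto_const] lim[OF c\<psi>], of "u q" "\<psi> q"]
      by simp
  qed
  have ll: "l' \<longlonglongrightarrow> l"
  proof -
    have "(\<lambda>n. l' n - l) \<longlonglongrightarrow> 0"
      by (rule Lim_null_comparison[OF _ e0]) (use w(1) in simp)
    then show ?thesis using LIM_zero_iff by blast
  qed
  have ev: "\<forall>\<^sub>F n in sequentially. inf_laplacian \<phi> (p n) \<le> - l' n * a (p n) * w n (p n) ^ 3"
  proof -
    have "\<forall>\<^sub>F n in sequentially. p n \<in> ball q R"
      using topological_tendstoD[OF pq open_ball, of q R] R(1) by simp
    then show ?thesis
    proof eventually_elim
      case (elim n)
      then obtain s where s: "s > 0" "ball (p n) s \<subseteq> ball q R"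
        using openE[OF open_ball, of "p n" q R] by blast
      have "has_local_min_in \<Omega> (\<lambda>x. w n x - \<phi> x) (p n)"
        unfolding has_local_min_in_def
        using p\<Omega>[of n] s(1) p(2)[of _ n] subsetD[OF s(2)] by fastforce
      from visc_supersolutionD[OF w(2) \<phi>(1) this] show ?case .
    qed
  qed
  have "inf_laplacian \<phi> q \<le> - l * a q * u q ^ 3"
    by (rule tendsto_le[OF _ _ _ ev])
       (auto intro!: tendsto_intros lim ll wl a continuous_on_inf_laplacian \<Omega> \<phi>)
  then show "inf_laplacian \<psi> q \<le> - l * a q * u q ^ 3" using \<phi>(2) by simp
qed

section \<open>Comparison with cones\<close>

lemma visc_supersolution_mono:
  assumes "visc_supersolution \<Omega> F u" "\<And>x. x \<in> \<Omega> \<Longrightarrow> F x (u x) \<le> G x (u x)"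
  shows "visc_supersolution \<Omega> G u"
  using assms unfolding visc_supersolution_def
  by (meson has_local_min_in_def order_trans)

text \<open>
  The right-hand side is the third order Taylor polynomial of \<open>\<surd>s\<close> at \<open>s = t\<^sup>2\<close>, evaluated at \<open>s = \<rho>\<^sup>2\<close>; the
  difference of the two sides is \<open>(\<rho> - t)\<^sup>4 (\<rho>\<^sup>2 + 4\<rho>t + 5t\<^sup>2) / (16 t\<^sup>5)\<close>.
\<close>
lemma sqrt_cubic_upper_bound:
  fixes t \<rho> :: real
  assumes "t > 0" "\<rho> \<ge> 0"
  shows "\<rho> \<le> ((\<rho>\<^sup>2) ^ 3 / t ^ 5 - 5 * (\<rho>\<^sup>2)\<^sup>2 / t ^ 3 + 15 * \<rho>\<^sup>2 / t + 5 * t) / 16"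
proof -
  have "((\<rho>\<^sup>2) ^ 3 / t ^ 5 - 5 * (\<rho>\<^sup>2)\<^sup>2 / t ^ 3 + 15 * \<rho>\<^sup>2 / t + 5 * t) / 16 - \<rho>
      = (\<rho> - t) ^ 4 * (\<rho>\<^sup>2 + 4 * \<rho> * t + 5 * t\<^sup>2) / (16 * t ^ 5)"
  proof -
    have "(\<rho> - t) ^ 4 * (\<rho>\<^sup>2 + 4 * \<rho> * t + 5 * t\<^sup>2)
        = \<rho> ^ 6 - 5 * \<rho> ^ 4 * t\<^sup>2 + 15 * \<rho>\<^sup>2 * t ^ 4 + 5 * t ^ 6 - 16 * \<rho> * t ^ 5"
      by (simp add: algebra_simps eval_nat_numeral)
    then show ?thesis using assms by (simp add: field_simps eval_nat_numeral)
  qed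
  moreover have "\<dots> \<ge> 0" using assms by simp
  ultimately show ?thesis by linarith
qed

text \<open>
  The cone with a small multiple of \<open>\<rho>\<^sup>2 - R\<^sup>2\<close> added is a strict subsolution away from its vertex, so \<open>u\<close>
  minus it cannot have a negative minimum there; at the vertex and on the sphere the difference is
  nonnegative anyway. Test functions have to be smooth in all of \<open>\<Omega>\<close>, in particular at the vertex \<open>y\<close>. Hence
  at the minimum point the distance \<open>\<surd>s\<close> is replaced by its cubic Taylor polynomial in \<open>s\<close>, which lies above
  it and has the same second order data.
\<close>
lemma superharmonic_above_cone:
  assumes \<Omega>: "open \<Omega>" and u: "visc_supersolution \<Omega> (\<lambda>x t. 0) u" and nonneg: "\<And>x. x \<in> \<Omega> \<Longrightarrow> 0 \<le> u x"
    and R: "R > 0" "cball y R \<subseteq> \<Omega>" and x: "x \<in> cball y R"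
  shows "u y * (1 - dist x y / R) \<le> u x"
proof (cases "u y = 0")
  case True
  then show ?thesis using nonneg x R by auto
next
  case False
  define c where "c = u y"
  have c: "c > 0" using False nonneg[of y] R unfolding c_def by force
  have strict: "c * (1 - dist x y / R) + \<epsilon> * ((dist x y)\<^sup>2 - R\<^sup>2) \<le> u x"
    if \<epsilon>: "\<epsilon> > 0" "2 * \<epsilon> * R\<^sup>2 < c" and x: "x \<in> cball y R" for \<epsilon> x
  proof -
    define \<phi> where "\<phi> = (\<lambda>x. c * (1 - dist x y / R) + \<epsilon> * ((dist x y)\<^sup>2 - R\<^sup>2))"
    have "continuous_on (cball y R) u"
      using u R continuous_on_subset unfolding visc_supersolution_def by blast
    then have "continuous_on (cball y R) (\<lambda>x. u x - \<phi> x)"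
      unfolding \<phi>_def by (intro continuous_intros) (use R in auto)
    then obtain q where q: "q \<in> cball y R" "\<And>x. x \<in> cball y R \<Longrightarrow> u q - \<phi> q \<le> u x - \<phi> x"
      using continuous_attains_inf[OF compact_cball, of y R "\<lambda>x. u x - \<phi> x"] R by force
    have "0 \<le> u q - \<phi> q"
    proof (rule ccontr)
      assume neg: "\<not> 0 \<le> u q - \<phi> q"
      define t where "t = dist q y"
      have "t \<le> R" using q by (simp add: t_def dist_commute)
      moreover have "t \<noteq> R"
      proof
        assume "t = R"
        then have "\<phi> q = 0" using R by (simp add: \<phi>_def t_def)
        then show False using neg nonneg[of q] q R by auto
      qed
      moreover have "q \<noteq> y"
      proof
        assume "q = y"
        then have "u q - \<phi> q = \<epsilon> * R\<^sup>2" by (simp add: \<phi>_def c_def)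
        then show False using neg \<epsilon> by simp
      qed
      ultimately have t: "0 < t" "t < R" by (auto simp: t_def)
      define h where "h = (\<lambda>s. c * (1 - ((s ^ 3 / t ^ 5 - 5 * s\<^sup>2 / t ^ 3 + 15 * s / t + 5 * t) / 16) / R)
                            + \<epsilon> * (s - R\<^sup>2))"
      define h' where "h' = (\<lambda>s. - c / R * ((3 * s\<^sup>2 / t ^ 5 - 10 * s / t ^ 3 + 15 / t) / 16) + \<epsilon>)"
      define h'' where "h'' = (\<lambda>s. - c / R * ((6 * s / t ^ 5 - 10 / t ^ 3) / 16))"
      define \<psi> where "\<psi> = (\<lambda>x. h ((x - y) \<bullet> (x - y)))"
      have sq: "(x - y) \<bullet> (x - y) = (dist x y)\<^sup>2" for x
        by (simp add: dist_norm power2_norm_eq_inner)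
      have d1: "(h has_real_derivative h' s) (at s)" for s
        unfolding h_def h'_def using t R
        by (auto intro!: derivative_eq_intros simp: field_simps)
      have d2: "(h' has_real_derivative h'' s) (at s)" for s
        unfolding h'_def h''_def using t R
        by (auto intro!: derivative_eq_intros simp: field_simps)
      have d3: "continuous_on A h''" for A
        unfolding h''_def by (intro continuous_intros) (use t R in auto)
      have q\<Omega>: "q \<in> \<Omega>" using q R by blast
      note rad = inf_laplacian_radial[where h = h and h' = h' and h'' = h'' and y = y, OF \<Omega> d1 d2 d3]
      have C2: "C2_on \<Omega> \<psi>" unfolding \<psi>_def by (rule rad(1))
      have "inf_laplacian \<psi> q = 8 * t\<^sup>2 * (h' (t\<^sup>2))\<^sup>2 * (h' (t\<^sup>2) + 2 * t\<^sup>2 * h'' (t\<^sup>2))"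
        using rad(2)[OF q\<Omega>] unfolding \<psi>_def sq t_def by simp
      moreover have h't: "h' (t\<^sup>2) = - c / (2 * R * t) + \<epsilon>"
        unfolding h'_def using t R by (simp add: field_simps eval_nat_numeral)
      moreover have "h' (t\<^sup>2) + 2 * t\<^sup>2 * h'' (t\<^sup>2) = \<epsilon>"
        unfolding h't h''_def using t R by (simp add: field_simps eval_nat_numeral)
      moreover have "h' (t\<^sup>2) \<noteq> 0"
      proof
        assume "h' (t\<^sup>2) = 0"
        then have "c = 2 * \<epsilon> * R * t" unfolding h't using t R by (simp add: field_simps)
        moreover have "2 * \<epsilon> * R * t \<le> 2 * \<epsilon> * R * R"
          using t R \<epsilon> by (intro mult_left_mono) auto
        ultimately show False using \<epsilon>(2) by (simp add: power2_eq_square)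
      qed
      ultimately have pos: "inf_laplacian \<psi> q > 0" using \<epsilon>(1) t by simp
      have below: "\<psi> x \<le> \<phi> x" for x
      proof -
        have "dist x y \<le> (((dist x y)\<^sup>2) ^ 3 / t ^ 5 - 5 * ((dist x y)\<^sup>2)\<^sup>2 / t ^ 3 + 15 * (dist x y)\<^sup>2 / t + 5 * t) / 16"
          by (rule sqrt_cubic_upper_bound) (use t in auto)
        then show ?thesis unfolding \<psi>_def sq h_def \<phi>_def using c R
          by (intro add_right_mono mult_left_mono diff_left_mono divide_right_mono) auto
      qed
      have touch: "\<psi> q = \<phi> q"
      proof -
        have T: "(((t\<^sup>2) ^ 3 / t ^ 5 - 5 * (t\<^sup>2)\<^sup>2 / t ^ 3 + 15 * t\<^sup>2 / t + 5 * t) / 16) = t"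
          using t by (simp add: field_simps eval_nat_numeral)
        show ?thesis unfolding \<psi>_def sq h_def \<phi>_def t_def[symmetric] T by simp
      qed
      have "has_local_min_in \<Omega> (\<lambda>x. u x - \<psi> x) q"
        unfolding has_local_min_in_def
      proof (intro conjI exI[of _ "R - t"] ballI)
        fix x assume "x \<in> \<Omega> \<inter> ball q (R - t)"
        then have "dist y x \<le> R" using dist_triangle[of y x q] dist_commute[of y q] by (simp add: t_def)
        then show "u q - \<psi> q \<le> u x - \<psi> x" using q(2)[of x] below[of x] touch by simp
      qed (use q\<Omega> t in auto)
      from visc_supersolutionD[OF u C2 this] pos show False by simp
    qed
    then show ?thesis using q(2)[OF x] unfolding \<phi>_def by linarith
  qed
  \<comment> \<open>Let the parameter \<open>\<epsilon>\<close> tend to 0.\<close>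
  show ?thesis
  proof (rule field_le_epsilon)
    fix e :: real assume e: "e > 0"
    define \<epsilon> where "\<epsilon> = min (c / (4 * R\<^sup>2)) (e / R\<^sup>2)"
    have "\<epsilon> > 0" unfolding \<epsilon>_def using c e R by simp
    moreover have "\<epsilon> * R\<^sup>2 \<le> c / 4"
    proof -
      have "\<epsilon> * R\<^sup>2 \<le> c / (4 * R\<^sup>2) * R\<^sup>2" unfolding \<epsilon>_def by (intro mult_right_mono) auto
      then show ?thesis using R by simp
    qed
    moreover have eR: "\<epsilon> * R\<^sup>2 \<le> e"
    proof -
      have "\<epsilon> * R\<^sup>2 \<le> e / R\<^sup>2 * R\<^sup>2" unfolding \<epsilon>_def by (intro mult_right_mono) auto
      then show ?thesis using R by simp
    qed
    ultimately have "c * (1 - dist x y / R) + \<epsilon> * ((dist x y)\<^sup>2 - R\<^sup>2) \<le> u x"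
      using strict[of \<epsilon> x] x c by simp
    moreover have "0 \<le> \<epsilon> * (dist x y)\<^sup>2" using \<open>\<epsilon> > 0\<close> by simp
    ultimately show "u y * (1 - dist x y / R) \<le> u x + e"
      using eR unfolding c_def by (simp add: right_diff_distrib)
  qed
qed

text \<open>
  The part of infinity-superharmonicity that remains in use. It is kept as a separate notion because it
  passes to infima, before anything about continuity of the infimum is known.
\<close>
definition above_cones :: "(real ^ 'n) set \<Rightarrow> (real ^ 'n \<Rightarrow> real) \<Rightarrow> bool" where
  "above_cones \<Omega> u \<longleftrightarrow> (\<forall>x\<in>\<Omega>. 0 \<le> u x) \<and>
     (\<forall>y R. R > 0 \<longrightarrow> cball y R \<subseteq> \<Omega> \<longrightarrow> (\<forall>x\<in>cball y R. u y * (1 - dist x y / R) \<le> u x))"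

lemma visc_supersolution_above_cones:
  assumes "open \<Omega>" "visc_supersolution \<Omega> (eigen_rhs a l) u" "l \<ge> 0"
    "\<And>x. x \<in> \<Omega> \<Longrightarrow> 0 \<le> a x" "\<And>x. x \<in> \<Omega> \<Longrightarrow> 0 \<le> u x"
  shows "above_cones \<Omega> u"
proof -
  have "visc_supersolution \<Omega> (\<lambda>x t. 0) u"
    using assms by (intro visc_supersolution_mono[OF assms(2)]) auto
  then show ?thesis unfolding above_cones_def
    using superharmonic_above_cone[OF assms(1), of u] assms(5) by blast
qed

text \<open>
  Apply the cone inequality with vertex \<open>x\<close> and with vertex \<open>y\<close>. The second application first gives
  \<open>u y \<le> 2 u x\<close>, a Harnack inequality, so that the Lipschitz constant depends on \<open>u x\<close> and \<open>R\<close> only.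
\<close>
lemma above_cones_diff:
  assumes u: "above_cones \<Omega> u" and R: "R > 0" "cball x (2 * R) \<subseteq> \<Omega>" and d: "dist y x \<le> R / 2"
  shows "\<bar>u y - u x\<bar> \<le> 2 * u x * dist y x / R"
proof -
  have "cball x R \<subseteq> cball x (2 * R)" using R by (intro subset_cball) auto
  then have xR: "cball x R \<subseteq> \<Omega>" using R(2) by blast
  have "cball y R \<subseteq> cball x (2 * R)"
  proof
    fix z assume "z \<in> cball y R"
    then show "z \<in> cball x (2 * R)" using dist_triangle[of x z y] d R(1) by (simp add: dist_commute)
  qed
  then have yR: "cball y R \<subseteq> \<Omega>" using R(2) by blast
  have x: "x \<in> \<Omega>" "y \<in> \<Omega>" using xR yR R by auto
  have nn: "u x \<ge> 0" "u y \<ge> 0" using u x unfolding above_cones_def by auto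
  define t where "t = dist y x / R"
  have t: "0 \<le> t" "t \<le> 1 / 2" unfolding t_def using d R by (auto simp: field_simps)
  have "y \<in> cball x R" "x \<in> cball y R" using d R(1) by (auto simp: dist_commute)
  have 1: "u x * (1 - t) \<le> u y"
    using u R(1) xR \<open>y \<in> cball x R\<close> unfolding above_cones_def t_def by blast
  have 2: "u y * (1 - t) \<le> u x"
    using u R(1) yR \<open>x \<in> cball y R\<close> unfolding above_cones_def t_def dist_commute[of y x] by blast
  have "u y * (1 / 2) \<le> u y * (1 - t)" using nn t by (intro mult_left_mono) auto
  then have "u y \<le> 2 * u x" using 2 by simp
  then have "u y * t \<le> 2 * u x * t" "u x * t \<le> 2 * u x * t" using t nn by (auto intro: mult_right_mono)
  then have "\<bar>u y - u x\<bar> \<le> 2 * u x * t" using 1 2 by (simp add: algebra_simps abs_le_iff)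
  then show ?thesis by (simp add: t_def)
qed

lemma above_cones_continuous_on:
  assumes \<Omega>: "open \<Omega>" and u: "above_cones \<Omega> u"
  shows "continuous_on \<Omega> u"
proof (rule continuous_at_imp_continuous_on, rule ballI)
  fix x assume x: "x \<in> \<Omega>"
  then obtain R0 where R0: "R0 > 0" "cball x R0 \<subseteq> \<Omega>" using \<Omega> open_contains_cball by blast
  define R where "R = R0 / 2"
  have R: "R > 0" "cball x (2 * R) \<subseteq> \<Omega>" using R0 by (auto simp: R_def)
  have "(u \<longlongrightarrow> u x) (at x)"
  proof (rule Lim_null[THEN iffD2], rule Lim_null_comparison)
    have "\<forall>\<^sub>F y in at x. dist y x < R / 2" using R by (auto simp: eventually_at intro!: exI[of _ "R / 2"])
    then show "\<forall>\<^sub>F y in at x. norm (u y - u x) \<le> 2 * u x * dist y x / R"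
      by eventually_elim (use above_cones_diff[OF u R] in auto)
    have "((\<lambda>y. 2 * u x * dist y x / R) \<longlongrightarrow> 2 * u x * dist x x / R) (at x)"
      by (intro tendsto_intros) (use R in auto)
    then show "((\<lambda>y. 2 * u x * dist y x / R) \<longlongrightarrow> 0) (at x)" by simp
  qed
  then show "isCont u x" by (simp add: isCont_def)
qed

text \<open>
  By \<open>above_cones_diff\<close> the zero set is open as well as relatively closed.
\<close>
lemma above_cones_strictly_positive:
  assumes \<Omega>: "open \<Omega>" "connected \<Omega>" and u: "above_cones \<Omega> u" and p: "p \<in> \<Omega>" "u p > 0"
    and x: "x \<in> \<Omega>"
  shows "u x > 0"
proof -
  define Z where "Z = {x \<in> \<Omega>. u x = 0}"
  define P where "P = {x \<in> \<Omega>. u x \<noteq> 0}"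
  have "open P" 
    unfolding P_def using continuous_open_preimage[OF above_cones_continuous_on[OF \<Omega>(1) u] \<Omega>(1), of "- {0}"]
    by (simp add: vimage_def Int_def open_Compl)
  moreover have "open Z"
  proof (rule openI)
    fix z assume z: "z \<in> Z"
    then obtain R0 where R0: "R0 > 0" "cball z R0 \<subseteq> \<Omega>" using \<Omega> open_contains_cball unfolding Z_def by blast
    define R where "R = R0 / 2"
    have R: "R > 0" "cball z (2 * R) \<subseteq> \<Omega>" using R0 by (auto simp: R_def)
    have "ball z (R / 2) \<subseteq> Z"
    proof
      fix y assume y: "y \<in> ball z (R / 2)"
      have "y \<in> \<Omega>" using y R by auto
      moreover have "u y = 0"
        using above_cones_diff[OF u R, of y] y z by (simp add: Z_def dist_commute)
      ultimately show "y \<in> Z" by (simp add: Z_def)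
    qed
    then show "\<exists>e>0. ball z e \<subseteq> Z" using R by (intro exI[of _ "R / 2"]) auto
  qed
  ultimately have "Z \<inter> \<Omega> = {} \<or> P \<inter> \<Omega> = {}"
    by (intro connectedD[OF \<Omega>(2)]) (auto simp: Z_def P_def)
  moreover have "p \<in> P \<inter> \<Omega>" using p by (simp add: P_def)
  ultimately have "Z = {}" by (auto simp: Z_def)
  then have "u x \<noteq> 0" using x by (auto simp: Z_def)
  then show ?thesis using u x unfolding above_cones_def by force
qed

text \<open>
  Take the largest multiple \<open>t \<phi>\<close> of \<open>\<phi> = (1 - \<bar>x - y\<bar>\<^sup>2/R\<^sup>2)\<^sup>2\<close> below \<open>u\<close>; it touches \<open>u\<close> at a point \<open>q\<close> inside the
  ball, where the factors \<open>t\<^sup>3\<close> cancel. Near the sphere the infinity-Laplacian of \<open>\<phi>\<close> is nonnegative,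
  and elsewhere it is at least \<open>-108 R\<^sup>-\<^sup>4 \<phi>\<^sup>3\<close>.
\<close>
lemma eigenvalue_upper_bound:
  assumes \<Omega>: "open \<Omega>" and u: "visc_supersolution \<Omega> (eigen_rhs a l) u" and pos: "\<And>x. x \<in> \<Omega> \<Longrightarrow> 0 < u x"
    and R: "R > 0" "cball y R \<subseteq> \<Omega>" and a: "\<And>x. x \<in> cball y R \<Longrightarrow> \<alpha> \<le> a x" and l: "l \<ge> 0"
  shows "l * \<alpha> * R ^ 4 \<le> 108"
proof (rule ccontr)
  assume big: "\<not> l * \<alpha> * R ^ 4 \<le> 108"
  define L where "L = l * \<alpha> * R ^ 4"
  define \<phi> where "\<phi> = (\<lambda>x. (1 - ((x - y) \<bullet> (x - y)) / R\<^sup>2)\<^sup>2)"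
  have cu: "continuous_on (cball y R) u"
    using u R continuous_on_subset unfolding visc_supersolution_def by blast
  have up: "u x > 0" if "x \<in> cball y R" for x using pos that R by blast
  have une: "u x \<noteq> 0" if "x \<in> cball y R" for x using up[OF that] by simp
  have cont: "continuous_on (cball y R) (\<lambda>x. \<phi> x / u x)"
    unfolding \<phi>_def by (intro continuous_intros cu) (use R une in simp_all)
  obtain q where q: "q \<in> cball y R" "\<And>x. x \<in> cball y R \<Longrightarrow> \<phi> x / u x \<le> \<phi> q / u q"
    using continuous_attains_sup[OF compact_cball _ cont] R by force
  have y: "y \<in> cball y R" using R by simp
  have "0 < \<phi> y / u y" using up[OF y] by (simp add: \<phi>_def)
  then have "0 < \<phi> q / u q" using q(2)[OF y] by linarith
  then have \<phi>q: "\<phi> q > 0" using up[OF q(1)] by (simp add: zero_less_divide_iff)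
  define t where "t = u q / \<phi> q"
  have t: "t > 0" using \<phi>q up[OF q(1)] by (simp add: t_def)
  have below: "t * \<phi> x \<le> u x" if "x \<in> cball y R" for x
    using q(2)[OF that] \<phi>q up[OF that] up[OF q(1)] unfolding t_def by (simp add: field_simps)
  have touch: "t * \<phi> q = u q" using \<phi>q by (simp add: t_def)
  define \<sigma> where "\<sigma> = ((q - y) \<bullet> (q - y)) / R\<^sup>2"
  have sq: "(x - y) \<bullet> (x - y) = (dist x y)\<^sup>2" for x
    by (simp add: dist_norm power2_norm_eq_inner)
  have "dist q y \<noteq> R" using \<phi>q R unfolding \<phi>_def sq by auto
  then have dq: "dist q y < R" using q(1) by (simp add: dist_commute)
  then have "(dist q y)\<^sup>2 < R\<^sup>2" by (intro power_strict_mono) auto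
  then have \<sigma>: "0 \<le> \<sigma>" "\<sigma> < 1" unfolding \<sigma>_def sq using R by (auto simp: field_simps)
  have q\<Omega>: "q \<in> \<Omega>" using q R by blast
  define h' where "h' = (\<lambda>s. - 2 * (1 - s / R\<^sup>2) / R\<^sup>2)"
  have d1: "((\<lambda>s. (1 - s / R\<^sup>2)\<^sup>2) has_real_derivative h' s) (at s)" for s
    unfolding h'_def using R by (auto intro!: derivative_eq_intros simp: field_simps)
  have d2: "(h' has_real_derivative 2 / (R\<^sup>2 * R\<^sup>2)) (at s)" for s
    unfolding h'_def using R by (auto intro!: derivative_eq_intros simp: field_simps)
  note rad = inf_laplacian_radial[where h = "\<lambda>s. (1 - s / R\<^sup>2)\<^sup>2" and h' = h' and h'' = "\<lambda>s. 2 / (R\<^sup>2 * R\<^sup>2)" and y = y,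
      OF \<Omega> d1 d2 continuous_on_const, folded \<phi>_def]
  have C2: "C2_on \<Omega> \<phi>" using rad(1) .
  have lap: "R ^ 4 * inf_laplacian \<phi> q = 64 * \<sigma> * (1 - \<sigma>)\<^sup>2 * (3 * \<sigma> - 1)"
  proof -
    have s: "(q - y) \<bullet> (q - y) = \<sigma> * R\<^sup>2" using R by (simp add: \<sigma>_def)
    have 1: "h' (\<sigma> * R\<^sup>2) = - 2 * (1 - \<sigma>) / R\<^sup>2" using R by (simp add: h'_def)
    have 2: "- 2 * (1 - \<sigma>) / R\<^sup>2 + 2 * (\<sigma> * R\<^sup>2) * (2 / (R\<^sup>2 * R\<^sup>2)) = (6 * \<sigma> - 2) / R\<^sup>2"
      using R by (simp add: field_simps)
    have 3: "8 * (\<sigma> * P) * (- 2 * (1 - \<sigma>) / P)\<^sup>2 * ((6 * \<sigma> - 2) / P)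
        = (64 * \<sigma> * (1 - \<sigma>)\<^sup>2 * (3 * \<sigma> - 1)) / (P * P)" if "P \<noteq> 0" for P :: real
      using that by (simp add: power_divide power_mult_distrib) (simp add: field_simps power2_eq_square)
    have "inf_laplacian \<phi> q = 8 * (\<sigma> * R\<^sup>2) * (- 2 * (1 - \<sigma>) / R\<^sup>2)\<^sup>2 * ((6 * \<sigma> - 2) / R\<^sup>2)"
      using rad(2)[OF q\<Omega>] unfolding s 1 2 .
    also have "\<dots> = (64 * \<sigma> * (1 - \<sigma>)\<^sup>2 * (3 * \<sigma> - 1)) / (R\<^sup>2 * R\<^sup>2)"
      by (rule 3) (use R in simp)
    finally show ?thesis using R by (simp add: power4_eq_xxxx power2_eq_square)
  qed
  have "has_local_min_in \<Omega> (\<lambda>x. u x - t * \<phi> x) q"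
    unfolding has_local_min_in_def
  proof (intro conjI exI[of _ "R - dist q y"] ballI)
    fix x assume "x \<in> \<Omega> \<inter> ball q (R - dist q y)"
    then have "x \<in> cball y R" using dist_triangle[of y x q] dist_commute[of y q] by simp
    then show "u q - t * \<phi> q \<le> u x - t * \<phi> x" using below[of x] touch by simp
  qed (use q\<Omega> dq in auto)
  from visc_supersolutionD[OF u C2_on_scale[OF C2] this]
  have "t ^ 3 * inf_laplacian \<phi> q \<le> - l * a q * (t * \<phi> q) ^ 3"
    using inf_laplacian_scale[OF \<Omega> q\<Omega> C2] touch by simp
  also have "\<dots> \<le> - (l * \<alpha>) * (t * \<phi> q) ^ 3"
  proof -
    have "l * \<alpha> * (t * \<phi> q) ^ 3 \<le> l * a q * (t * \<phi> q) ^ 3"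
      using a[OF q(1)] l t \<phi>q by (intro mult_right_mono mult_left_mono) auto
    then show ?thesis by simp
  qed
  finally have "t ^ 3 * inf_laplacian \<phi> q \<le> t ^ 3 * (- (l * \<alpha>) * \<phi> q ^ 3)"
    by (simp add: power_mult_distrib mult_ac)
  then have "inf_laplacian \<phi> q \<le> - (l * \<alpha>) * \<phi> q ^ 3"
    by (rule mult_left_le_imp_le) (use t in simp)
  then have "R ^ 4 * inf_laplacian \<phi> q \<le> R ^ 4 * (- (l * \<alpha>) * \<phi> q ^ 3)"
    using R by (intro mult_left_mono) auto
  moreover have "R ^ 4 * (- (l * \<alpha>) * \<phi> q ^ 3) = (1 - \<sigma>)\<^sup>2 * (- L * (1 - \<sigma>) ^ 4)"
  proof -
    have \<phi>\<sigma>: "\<phi> q = (1 - \<sigma>)\<^sup>2" by (simp add: \<phi>_def \<sigma>_def)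
    have p6: "((1 - \<sigma>)\<^sup>2) ^ 3 = (1 - \<sigma>)\<^sup>2 * (1 - \<sigma>) ^ 4"
      by (simp flip: power_mult power_add)
    show ?thesis unfolding \<phi>\<sigma> p6 L_def by simp
  qed
  moreover have "64 * \<sigma> * (1 - \<sigma>)\<^sup>2 * (3 * \<sigma> - 1) = (1 - \<sigma>)\<^sup>2 * (64 * \<sigma> * (3 * \<sigma> - 1))"
    by simp
  ultimately have "(1 - \<sigma>)\<^sup>2 * (64 * \<sigma> * (3 * \<sigma> - 1)) \<le> (1 - \<sigma>)\<^sup>2 * (- L * (1 - \<sigma>) ^ 4)"
    unfolding lap by linarith
  then have main: "64 * \<sigma> * (3 * \<sigma> - 1) \<le> - L * (1 - \<sigma>) ^ 4"
    by (rule mult_left_le_imp_le) (use \<sigma> in simp)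
  have L: "L > 108" using big by (simp add: L_def)
  have "0 < L * (1 - \<sigma>) ^ 4" using L \<sigma> by simp
  then have "\<sigma> * (3 * \<sigma> - 1) < 0" using main by simp
  then have s3: "\<sigma> < 1 / 3" using \<sigma> by (simp add: mult_less_0_iff)
  then have "(2 / 3) ^ 4 \<le> (1 - \<sigma>) ^ 4" by (intro power_mono) auto
  then have "108 * (2 / 3) ^ 4 \<le> L * (1 - \<sigma>) ^ 4" using L \<sigma> by (intro mult_mono) auto
  moreover have "64 * \<sigma> * (3 * \<sigma> - 1) \<ge> -64 / 12"
  proof -
    have "0 \<le> 192 * (\<sigma> - 1 / 6)\<^sup>2" by simp
    then show ?thesis by (simp add: power2_eq_square algebra_simps)
  qed
  ultimately show False using main by (simp add: power4_eq_xxxx)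
qed

section \<open>Perron's method from above\<close>

lemma visc_solution_cong:
  assumes "visc_solution \<Omega> F u" "\<And>x. x \<in> \<Omega> \<Longrightarrow> v x = u x"
  shows "visc_solution \<Omega> F v"
proof -
  have "has_local_max_in \<Omega> (\<lambda>x. v x - \<psi> x) p \<longleftrightarrow> has_local_max_in \<Omega> (\<lambda>x. u x - \<psi> x) p"
    "has_local_min_in \<Omega> (\<lambda>x. v x - \<psi> x) p \<longleftrightarrow> has_local_min_in \<Omega> (\<lambda>x. u x - \<psi> x) p" for \<psi> p
    unfolding has_local_max_in_def has_local_min_in_def using assms(2) by auto
  moreover have "has_local_max_in \<Omega> f p \<Longrightarrow> p \<in> \<Omega>" "has_local_min_in \<Omega> f p \<Longrightarrow> p \<in> \<Omega>" for f p
    unfolding has_local_max_in_def has_local_min_in_def by auto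
  moreover have "continuous_on \<Omega> v \<longleftrightarrow> continuous_on \<Omega> u"
    using assms(2) by (rule continuous_on_cong[OF refl])
  ultimately show ?thesis
    using assms unfolding visc_solution_def visc_subsolution_def visc_supersolution_def by metis
qed

text \<open>
  The profile \<open>f(\<rho>) = d + K(\<rho> - \<rho>\<^sup>2/(4r))\<close> is a cone made slightly concave:
  \<open>f'\<^sup>2 f'' = - K\<^sup>3 (1 - \<rho>/(2r))\<^sup>2 / (2r)\<close>, and \<open>1 - \<rho>/(2r) > 1/2\<close> for \<open>\<rho> < r\<close>.
\<close>
lemma barrier:
  fixes z :: "real ^ 'n" and d :: real
  assumes \<Omega>: "open \<Omega>" "z \<notin> \<Omega>" and r: "r > 0" and K: "K \<ge> 0"
  defines "\<phi> \<equiv> \<lambda>x. d + K * (dist x z - (dist x z)\<^sup>2 / (4 * r))"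
  shows "C2_on \<Omega> \<phi>"
    and "x \<in> \<Omega> \<Longrightarrow> dist x z < r \<Longrightarrow> inf_laplacian \<phi> x \<le> - (K ^ 3 / (8 * r))"
proof -
  have sq: "(x - z) \<bullet> (x - z) = (dist x z)\<^sup>2" for x
    by (simp add: dist_norm power2_norm_eq_inner)
  define h where "h = (\<lambda>s. d + K * (sqrt s - s / (4 * r)))"
  define h' where "h' = (\<lambda>s. K * (inverse (sqrt s) / 2 - 1 / (4 * r)))"
  define h'' where "h'' = (\<lambda>s. K * (- (inverse (sqrt s) / 2) / (sqrt s * sqrt s)) / 2)"
  have \<phi>: "\<phi> = (\<lambda>x. h ((x - z) \<bullet> (x - z)))"
    unfolding \<phi>_def h_def sq by simp
  have pos: "(x - z) \<bullet> (x - z) > 0" if "x \<in> \<Omega>" for x using that \<Omega>(2) by auto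
  have d1: "(h has_real_derivative h' s) (at s)" if "s > 0" for s
    unfolding h_def h'_def using that r
    by (auto intro!: derivative_eq_intros simp: field_simps)
  have d2: "(h' has_real_derivative h'' s) (at s)" if "s > 0" for s
    unfolding h'_def h''_def using that r
    by (auto intro!: derivative_eq_intros simp: field_simps)
  have d3: "continuous_on ((\<lambda>x. (x - z) \<bullet> (x - z)) ` \<Omega>) h''"
    unfolding h''_def by (intro continuous_intros) (use pos in force)+
  note rad = inf_laplacian_radial[where h = h and h' = h' and h'' = h'' and y = z,
      OF \<Omega>(1) d1[OF pos] d2[OF pos] d3, folded \<phi>]
  show "C2_on \<Omega> \<phi>" by (rule rad(1))
  assume x: "x \<in> \<Omega>" and near: "dist x z < r"
  define t where "t = dist x z"
  have t: "0 < t" "t < r" using x \<Omega> near by (auto simp: t_def)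
  have lap: "inf_laplacian \<phi> x = 8 * t\<^sup>2 * (h' (t\<^sup>2))\<^sup>2 * (h' (t\<^sup>2) + 2 * t\<^sup>2 * h'' (t\<^sup>2))"
    using rad(2)[OF _ _ x] unfolding sq t_def by simp
  have 1: "h' (t\<^sup>2) = K / t * (1 / 2 - t / (4 * r))"
    unfolding h'_def using t r by (simp add: field_simps)
  have 2: "h' (t\<^sup>2) + 2 * t\<^sup>2 * h'' (t\<^sup>2) = - K / (4 * r)"
    unfolding h'_def h''_def using t r by (simp add: field_simps power2_eq_square)
  have "inf_laplacian \<phi> x = - (K ^ 3 / (8 * r)) * (16 * (1 / 2 - t / (4 * r))\<^sup>2)"
    unfolding lap 2 unfolding 1 power_mult_distrib power_divide using t r
    by (simp add: field_simps eval_nat_numeral)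
  moreover have "1 / 4 \<le> 1 / 2 - t / (4 * r)" using t r by (simp add: field_simps)
  then have "(1 / 4)\<^sup>2 \<le> (1 / 2 - t / (4 * r))\<^sup>2" by (intro power_mono) auto
  then have "1 \<le> 16 * (1 / 2 - t / (4 * r))\<^sup>2" by (simp add: power2_eq_square)
  then have "K ^ 3 / (8 * r) * 1 \<le> K ^ 3 / (8 * r) * (16 * (1 / 2 - t / (4 * r))\<^sup>2)"
    using K r by (intro mult_left_mono) auto
  ultimately show "inf_laplacian \<phi> x \<le> - (K ^ 3 / (8 * r))" by linarith
qed

locale perron =
  fixes \<Omega> :: "(real ^ 'n) set" and a :: "real ^ 'n \<Rightarrow> real" and l \<delta> :: real
  assumes op: "open \<Omega>" and ca: "continuous_on \<Omega> a" and a_pos: "\<And>x. x \<in> \<Omega> \<Longrightarrow> a x > 0"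
    and l_pos: "l > 0" and \<delta>_pos: "\<delta> > 0"
    and ex: "\<exists>w. visc_supersolution \<Omega> (eigen_rhs a l) w \<and> (\<forall>x\<in>\<Omega>. \<delta> \<le> w x)"
begin

definition fam :: "(real ^ 'n \<Rightarrow> real) set" where
  "fam = {w. visc_supersolution \<Omega> (eigen_rhs a l) w \<and> (\<forall>x\<in>\<Omega>. \<delta> \<le> w x)}"

definition least :: "real ^ 'n \<Rightarrow> real" where
  "least x = (INF w\<in>fam. w x)"

lemma least_le: "w \<in> fam \<Longrightarrow> x \<in> \<Omega> \<Longrightarrow> least x \<le> w x"
  unfolding least_def by (rule cINF_lower) (auto simp: fam_def intro!: bdd_belowI2[of _ \<delta>])

lemma fam_ne: "fam \<noteq> {}" using ex by (auto simp: fam_def)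

lemma least_greatest: "(\<And>w. w \<in> fam \<Longrightarrow> m \<le> w x) \<Longrightarrow> m \<le> least x"
  unfolding least_def using fam_ne by (rule cINF_greatest)

lemma delta_le_least: "x \<in> \<Omega> \<Longrightarrow> \<delta> \<le> least x"
  by (rule least_greatest) (auto simp: fam_def)

lemma least_approx:
  assumes "x \<in> \<Omega>" "e > 0" shows "\<exists>w\<in>fam. w x < least x + e"
proof (rule ccontr)
  assume "\<not> ?thesis"
  then have "least x + e \<le> least x" by (intro least_greatest) (auto simp: not_less)
  then show False using assms by simp
qed

lemma above_cones_least: "above_cones \<Omega> least"
  unfolding above_cones_def
proof (intro conjI ballI allI impI)
  show "0 \<le> least x" if "x \<in> \<Omega>" for x using delta_le_least[OF that] \<delta>_pos by simp
  fix y x R assume R: "0 < R" "cball y R \<subseteq> \<Omega>" and x: "x \<in> cball y R"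
  have y: "y \<in> \<Omega>" using R by auto
  show "least y * (1 - dist x y / R) \<le> least x"
  proof (rule least_greatest)
    fix w assume w: "w \<in> fam"
    then have "above_cones \<Omega> w"
      using l_pos \<delta>_pos a_pos unfolding fam_def
      by (intro visc_supersolution_above_cones[OF op, of l a]) (auto intro: less_imp_le order_trans[OF less_imp_le])
    then have "w y * (1 - dist x y / R) \<le> w x"
      using R x unfolding above_cones_def by blast
    moreover have "least y * (1 - dist x y / R) \<le> w y * (1 - dist x y / R)"
      using x R least_le[OF w y] by (intro mult_right_mono) (auto simp: dist_commute)
    ultimately show "least y * (1 - dist x y / R) \<le> w x" by linarith
  qed
qed

lemma continuous_on_least: "continuous_on \<Omega> least"
  by (rule above_cones_continuous_on[OF op above_cones_least])

lemma least_supersolution: "visc_supersolution \<Omega> (eigen_rhs a l) least"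
proof (rule visc_supersolution_limit[OF op ca continuous_on_least])
  fix q and e :: real assume "q \<in> \<Omega>" "e > 0"
  then obtain w where w: "w \<in> fam" "w q < least q + e" using least_approx by blast
  have "visc_supersolution \<Omega> (eigen_rhs a l) w" using w(1) by (simp add: fam_def)
  moreover have "\<forall>x\<in>\<Omega>. least x - e \<le> w x" using least_le[OF w(1)] \<open>e > 0\<close> by force
  ultimately show "\<exists>l' w. \<bar>l' - l\<bar> \<le> e \<and> visc_supersolution \<Omega> (eigen_rhs a l') w
      \<and> w q \<le> least q + e \<and> (\<forall>x\<in>\<Omega>. least x - e \<le> w x)"
    using w(2) \<open>e > 0\<close> by (intro exI[of _ l] exI[of _ w]) auto
qed

text \<open>
  A constant function touches a supersolution from below at an interior minimum, which contradicts
  \<open>l a(x) \<delta>\<^sup>3 > 0\<close>. Thus the constraint \<open>\<ge> \<delta>\<close> is nowhere active in \<open>\<Omega>\<close>.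
\<close>
lemma delta_less_least: assumes x: "x \<in> \<Omega>" shows "\<delta> < least x"
proof (rule ccontr)
  assume "\<not> \<delta> < least x"
  then have "least x = \<delta>" using delta_le_least[OF x] by simp
  then have "has_local_min_in \<Omega> (\<lambda>y. least y - 0) x"
    unfolding has_local_min_in_def using delta_le_least x by (auto intro!: exI[of _ 1])
  from visc_supersolutionD[OF least_supersolution C2_on_const this]
  have "0 \<le> - l * a x * \<delta> ^ 3" unfolding \<open>least x = \<delta>\<close> inf_laplacian_const .
  moreover have "0 < l * a x * \<delta> ^ 3" using l_pos a_pos[OF x] \<delta>_pos by simp
  ultimately show False by simp
qed

text \<open>
  Minimality in the form in which it is used twice: for the subsolution property, with \<open>\<phi>\<close> a lowered
  test function, and for the boundary behaviour, with \<open>\<phi>\<close> a barrier.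
\<close>
lemma least_minimal_glue:
  assumes "open U" "closed C" "C \<subseteq> U"
    and \<phi>: "C2_on \<Omega> \<phi>" "\<And>x. x \<in> \<Omega> \<inter> U \<Longrightarrow> inf_laplacian \<phi> x \<le> - l * a x * \<phi> x ^ 3"
    and above: "\<And>x. x \<in> \<Omega> \<inter> U - C \<Longrightarrow> least x \<le> \<phi> x"
    and \<delta>: "\<And>x. x \<in> \<Omega> \<inter> U \<Longrightarrow> \<delta> \<le> \<phi> x"
    and x: "x \<in> \<Omega> \<inter> U"
  shows "least x \<le> \<phi> x"
proof -
  let ?w = "\<lambda>x. if x \<in> U then min (least x) (\<phi> x) else least x"
  have "?w \<in> fam"
    using visc_supersolution_glue[OF op assms(1-3) least_supersolution \<phi> above] \<delta> delta_le_least
    unfolding fam_def by auto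
  from least_le[OF this, of x] x show ?thesis by auto
qed

text \<open>
  If a test function \<open>\<psi>\<close> touching from above at \<open>p\<close> violated the inequality, then \<open>\<psi> + \<bar>x - p\<bar>\<^sup>4\<close>, shifted to touch at
  \<open>p\<close> and lowered by a small \<open>e\<close>, would be a supersolution near \<open>p\<close>, above \<open>\<delta>\<close> by the strict inequality
  \<open>delta_less_least\<close>. Gluing it in would give a smaller member of the family.
\<close>
lemma least_subsolution: "visc_subsolution \<Omega> (eigen_rhs a l) least"
  unfolding visc_subsolution_def
proof (intro conjI allI impI)
  show "continuous_on \<Omega> least" by (rule continuous_on_least)
  fix \<psi> p assume "C2_on \<Omega> \<psi> \<and> has_local_max_in \<Omega> (\<lambda>x. least x - \<psi> x) p"
  then have \<psi>: "C2_on \<Omega> \<psi>" and m: "has_local_max_in \<Omega> (\<lambda>x. least x - \<psi> x) p" by auto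
  from m obtain r where p: "p \<in> \<Omega>" and r: "r > 0"
    "\<And>x. x \<in> \<Omega> \<inter> ball p r \<Longrightarrow> least x - \<psi> x \<le> least p - \<psi> p"
    unfolding has_local_max_in_def by blast
  show "- l * a p * least p ^ 3 \<le> inf_laplacian \<psi> p"
  proof (rule ccontr)
    assume neg: "\<not> ?thesis"
    define \<phi> where "\<phi> = (\<lambda>x. \<psi> x + 1 * ((x - p) \<bullet> (x - p))\<^sup>2 + (least p - \<psi> p))"
    note \<phi> = quartic_perturbation[OF op \<psi> p, of 1 "least p - \<psi> p", folded \<phi>_def]
    have \<phi>p: "\<phi> p = least p" by (simp add: \<phi>_def)
    have c\<phi>: "continuous_on \<Omega> \<phi>" by (rule C2_on_imp_continuous_on[OF \<phi>(1)])
    define G where "G = (\<lambda>x. inf_laplacian \<phi> x + l * a x * \<phi> x ^ 3)"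
    have cG: "continuous_on \<Omega> G"
      unfolding G_def by (intro continuous_intros c\<phi> ca continuous_on_inf_laplacian op \<phi>)
    have "G p < 0" using neg by (simp add: G_def \<phi> \<phi>p)
    define m where "m = (least p + \<delta>) / 2"
    have m: "\<delta> < m" "m < \<phi> p" using delta_less_least[OF p] by (auto simp: m_def \<phi>p)
    have "open (\<Omega> \<inter> G -` {..<0} \<inter> (\<Omega> \<inter> \<phi> -` {m<..}) \<inter> ball p r)"
      by (intro open_Int continuous_open_preimage cG c\<phi> op) auto
    moreover have "p \<in> \<Omega> \<inter> G -` {..<0} \<inter> (\<Omega> \<inter> \<phi> -` {m<..}) \<inter> ball p r"
      using p \<open>G p < 0\<close> m r by simp
    ultimately obtain \<rho> where \<rho>: "\<rho> > 0"
      "ball p \<rho> \<subseteq> \<Omega> \<inter> G -` {..<0} \<inter> (\<Omega> \<inter> \<phi> -` {m<..}) \<inter> ball p r"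
      using open_contains_ball by blast
    define e where "e = min (m - \<delta>) ((\<rho> / 2) ^ 4)"
    have e: "e > 0" "e \<le> m - \<delta>" "e \<le> (\<rho> / 2) ^ 4" using m \<rho> by (auto simp: e_def)
    have "least p \<le> \<phi> p + - e"
    proof (rule least_minimal_glue[of "ball p \<rho>" "cball p (\<rho> / 2)"])
      show "C2_on \<Omega> (\<lambda>x. \<phi> x + - e)" by (rule inf_laplacian_add_const[OF op \<phi>(1) p])
      show "cball p (\<rho> / 2) \<subseteq> ball p \<rho>" using \<rho> by auto
      show "p \<in> \<Omega> \<inter> ball p \<rho>" using p \<rho> by simp
      fix x
      show "\<delta> \<le> \<phi> x + - e" if "x \<in> \<Omega> \<inter> ball p \<rho>"
        using that \<rho>(2) e by force
      show "least x \<le> \<phi> x + - e" if x: "x \<in> \<Omega> \<inter> ball p \<rho> - cball p (\<rho> / 2)"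
      proof -
        have "(\<rho> / 2) ^ 4 \<le> dist x p ^ 4" using x \<rho> by (intro power_mono) (auto simp: dist_commute)
        also have "dist x p ^ 4 = ((x - p) \<bullet> (x - p))\<^sup>2"
          by (simp add: dist_norm flip: power2_norm_eq_inner power_mult)
        finally have "e \<le> ((x - p) \<bullet> (x - p))\<^sup>2" using e by simp
        moreover have "least x - \<psi> x \<le> least p - \<psi> p" using r(2)[of x] x \<rho>(2) by blast
        ultimately show ?thesis by (simp add: \<phi>_def)
      qed
      show "inf_laplacian (\<lambda>x. \<phi> x + - e) x \<le> - l * a x * (\<phi> x + - e) ^ 3" if x: "x \<in> \<Omega> \<inter> ball p \<rho>"
      proof -
        have "inf_laplacian (\<lambda>x. \<phi> x + - e) x = inf_laplacian \<phi> x"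
          using x by (intro inf_laplacian_add_const(2)[OF op \<phi>(1)]) auto
        moreover have "G x < 0" using x \<rho>(2) by auto
        moreover have "(\<phi> x + - e) ^ 3 \<le> \<phi> x ^ 3" using e by (intro power_mono_odd) auto
        then have "l * a x * (\<phi> x + - e) ^ 3 \<le> l * a x * \<phi> x ^ 3"
          using l_pos a_pos[of x] x by (intro mult_left_mono) auto
        ultimately show ?thesis by (simp add: G_def)
      qed
    qed auto
    then show False using e \<phi>p by simp
  qed
qed

text \<open>
  With \<open>K = 4M/r\<close> the barrier exceeds \<open>M\<close> for \<open>r/2 < \<rho> < r\<close>, so it can be glued. It is at most \<open>2Kr\<close>, so it is
  a supersolution as soon as \<open>8 l A (Kr)\<^sup>3 \<le> K\<^sup>3/(8r)\<close>, that is, \<open>64 l A r\<^sup>4 \<le> 1\<close>: the radius depends neither on \<open>M\<close>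
  nor on \<open>\<delta>\<close>, which makes the estimate uniform after normalisation.
\<close>
lemma least_boundary_bound:
  assumes M: "\<And>x. x \<in> \<Omega> \<Longrightarrow> least x \<le> M" and A: "\<And>x. x \<in> \<Omega> \<Longrightarrow> a x \<le> A"
    and z: "z \<notin> \<Omega>" and r: "r > 0" "64 * l * A * r ^ 4 \<le> 1" and x: "x \<in> \<Omega>"
  shows "least x \<le> \<delta> + 4 * M / r * dist x z"
proof -
  have \<delta>M: "\<delta> \<le> M" using delta_le_least[OF x] M[OF x] by simp
  then have Mpos: "M > 0" using \<delta>_pos by simp
  define K where "K = 4 * M / r"
  have K: "K > 0" "K * r = 4 * M" using Mpos r by (auto simp: K_def)
  show ?thesis
  proof (cases "dist x z < r")
    case False
    then have "K * r \<le> K * dist x z" using K by (intro mult_left_mono) auto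
    then show ?thesis using M[OF x] K Mpos \<delta>_pos by (simp add: K_def)
  next
    case True
    define \<phi> where "\<phi> = (\<lambda>x. \<delta> + K * (dist x z - (dist x z)\<^sup>2 / (4 * r)))"
    note bar = barrier[OF op z r(1) less_imp_le[OF K(1)], where d = \<delta>, folded \<phi>_def]
    have lower: "3 / 4 * t \<le> t - t\<^sup>2 / (4 * r)" if "0 \<le> t" "t < r" for t
    proof -
      have "t * t \<le> t * r" using that by (intro mult_left_mono) auto
      then have "t\<^sup>2 / (4 * r) \<le> t / 4" using r by (simp add: power2_eq_square field_simps)
      then show ?thesis by simp
    qed
    have upper: "t - t\<^sup>2 / (4 * r) \<le> t" for t using r by simp
    have "least x \<le> \<phi> x"
    proof (rule least_minimal_glue[of "ball z r" "cball z (r / 2)"])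
      show "C2_on \<Omega> \<phi>" by (rule bar(1))
      show "cball z (r / 2) \<subseteq> ball z r" using r by auto
      show "x \<in> \<Omega> \<inter> ball z r" using x True by (simp add: dist_commute)
      fix x
      show \<delta>\<phi>: "\<delta> \<le> \<phi> x" if "x \<in> \<Omega> \<inter> ball z r"
      proof -
        have "dist x z < r" using that by (simp add: dist_commute)
        then have "0 \<le> dist x z - (dist x z)\<^sup>2 / (4 * r)"
          using lower[OF zero_le_dist[of x z]] zero_le_dist[of x z] by linarith
        then show ?thesis using K by (simp add: \<phi>_def)
      qed
      show "least x \<le> \<phi> x" if "x \<in> \<Omega> \<inter> ball z r - cball z (r / 2)"
      proof -
        have d: "r / 2 < dist x z" "dist x z < r" using that by (auto simp: dist_commute)
        then have "3 / 4 * (r / 2) \<le> dist x z - (dist x z)\<^sup>2 / (4 * r)"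
          using lower[of "dist x z"] r(1) by linarith
        then have "K * (3 / 4 * (r / 2)) \<le> K * (dist x z - (dist x z)\<^sup>2 / (4 * r))"
          using K by (intro mult_left_mono) auto
        moreover have "K * (3 / 4 * (r / 2)) = 3 / 2 * M" using K by simp
        ultimately show ?thesis using M[of x] that \<delta>_pos Mpos by (simp add: \<phi>_def)
      qed
      show "inf_laplacian \<phi> x \<le> - l * a x * \<phi> x ^ 3" if x: "x \<in> \<Omega> \<inter> ball z r"
      proof -
        have d: "dist x z < r" using x by (simp add: dist_commute)
        have "K * (dist x z - (dist x z)\<^sup>2 / (4 * r)) \<le> K * r"
          using upper[of "dist x z"] d K by (intro mult_left_mono) auto
        then have "\<phi> x \<le> 2 * (K * r)" using \<delta>M K Mpos by (simp add: \<phi>_def)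
        then have "\<phi> x ^ 3 \<le> (2 * (K * r)) ^ 3" using \<delta>\<phi>[OF x] \<delta>_pos by (intro power_mono) auto
        moreover have "l * a x \<le> l * A" using A x l_pos by (intro mult_left_mono) auto
        ultimately have "l * a x * \<phi> x ^ 3 \<le> l * A * (2 * (K * r)) ^ 3"
          using l_pos a_pos[of x] A[of x] x \<delta>\<phi>[OF x] \<delta>_pos by (intro mult_mono) auto
        also have "\<dots> = K ^ 3 / (8 * r) * (64 * l * A * r ^ 4)"
          using r by (simp add: field_simps eval_nat_numeral)
        also have "\<dots> \<le> K ^ 3 / (8 * r) * 1" using r K by (intro mult_left_mono) auto
        finally show ?thesis using bar(2)[of x] x d by simp
      qed
    qed auto
    also have "\<dots> \<le> \<delta> + K * dist x z"
      using K upper[of "dist x z"] by (simp add: \<phi>_def mult_left_mono)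
    finally show ?thesis by (simp add: K_def)
  qed
qed

lemma positive_solution_least:
  assumes M: "\<And>x. x \<in> \<Omega> \<Longrightarrow> least x \<le> M" and A: "\<And>x. x \<in> \<Omega> \<Longrightarrow> a x \<le> A"
  shows "positive_solution \<Omega> a l \<delta> (\<lambda>x. if x \<in> \<Omega> then least x else \<delta>)" (is "positive_solution _ _ _ _ ?u")
  unfolding positive_solution_def
proof (intro conjI ballI)
  show "?u x > 0" if "x \<in> \<Omega>" for x using delta_less_least[OF that] \<delta>_pos that by simp
  show "?u x = \<delta>" if "x \<in> frontier \<Omega>" for x
    using that op by (auto simp: frontier_def interior_open)
  have "visc_solution \<Omega> (eigen_rhs a l) least"
    unfolding visc_solution_def using least_subsolution least_supersolution by blast
  then show "visc_solution \<Omega> (eigen_rhs a l) ?u"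
    by (rule visc_solution_cong) simp
  have "\<exists>r>0. 64 * l * A * r ^ 4 \<le> 1"
  proof -
    have "((\<lambda>r. 64 * l * A * r ^ 4) \<longlongrightarrow> 64 * l * A * 0 ^ 4) (at_right (0::real))"
      by (intro tendsto_intros)
    then have "\<forall>\<^sub>F r in at_right 0. 64 * l * A * r ^ 4 < 1"
      by (rule order_tendstoD(2)) simp
    moreover have "\<forall>\<^sub>F r in at_right (0::real). 0 < r" by (simp add: eventually_at_right_less)
    ultimately have "\<forall>\<^sub>F r in at_right 0. 0 < r \<and> 64 * l * A * r ^ 4 \<le> 1"
      by eventually_elim auto
    then show ?thesis using eventually_happens trivial_limit_at_right_real by blast
  qed
  then obtain r where r: "r > 0" "64 * l * A * r ^ 4 \<le> 1" by blast
  show "continuous_on (closure \<Omega>) ?u"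
    unfolding continuous_on_eq_continuous_within
  proof
    fix x assume x: "x \<in> closure \<Omega>"
    show "continuous (at x within closure \<Omega>) ?u"
    proof (cases "x \<in> \<Omega>")
      case True
      have "continuous_on \<Omega> ?u" using continuous_on_least by (rule continuous_on_eq) simp
      then have "continuous (at x) ?u" using True op continuous_on_eq_continuous_at by blast
      then show ?thesis by (rule continuous_at_imp_continuous_at_within)
    next
      case False
      have "((\<lambda>y. ?u y - ?u x) \<longlongrightarrow> 0) (at x within closure \<Omega>)"
      proof (rule Lim_null_comparison)
        have "\<bar>?u y - ?u x\<bar> \<le> \<bar>4 * M / r\<bar> * dist y x" for y
          using least_boundary_bound[OF M A False r, of y] delta_le_least[of y] False 
            mult_right_mono[OF abs_ge_self[of "4 * M / r"] zero_le_dist[of y x]] by auto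
        then show "\<forall>\<^sub>F y in at x within closure \<Omega>. norm (?u y - ?u x) \<le> \<bar>4 * M / r\<bar> * dist y x"
          by simp
        have "((\<lambda>y. \<bar>4 * M / r\<bar> * dist y x) \<longlongrightarrow> \<bar>4 * M / r\<bar> * dist x x) (at x within closure \<Omega>)"
          by (intro tendsto_intros)
        then show "((\<lambda>y. \<bar>4 * M / r\<bar> * dist y x) \<longlongrightarrow> 0) (at x within closure \<Omega>)" by simp
      qed
      then show ?thesis unfolding continuous_within by (rule LIM_zero_cancel)
    qed
  qed
qed

end

section \<open>The solvable set\<close>

text \<open>
  A nonempty open set has positive measure, so for a continuous function an essential upper bound is
  an upper bound.
\<close>
lemma L_infinity_on_continuous_bound:
  assumes "open \<Omega>" "continuous_on \<Omega> a" "L_infinity_on \<Omega> a"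
  shows "\<exists>A>0. \<forall>x\<in>\<Omega>. a x \<le> A"
proof -
  from assms(3) obtain M where M: "AE x in lebesgue_on \<Omega>. \<bar>a x\<bar> \<le> M"
    unfolding L_infinity_on_def by blast
  have "AE x in lebesgue. x \<in> \<Omega> \<longrightarrow> \<bar>a x\<bar> \<le> M"
    using M assms(1) by (subst (asm) AE_restrict_space_iff) (auto intro: borel_open)
  define S where "S = \<Omega> \<inter> a -` {M<..}"
  have "open S" unfolding S_def using assms by (intro continuous_open_preimage) auto
  have "AE x in lebesgue. x \<notin> S"
    using \<open>AE x in lebesgue. x \<in> \<Omega> \<longrightarrow> \<bar>a x\<bar> \<le> M\<close> by eventually_elim (auto simp: S_def)
  moreover have "S \<in> sets lebesgue" using \<open>open S\<close> by (auto intro: borel_open)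
  ultimately have "negligible S" using AE_iff_null_sets negligible_iff_null_sets by blast
  then have "S = {}" using open_not_negligible[OF \<open>open S\<close>] by blast
  then have "\<forall>x\<in>\<Omega>. a x \<le> max M 1" by (force simp: S_def)
  then show ?thesis by (intro exI[of _ "max M 1"]) auto
qed

text \<open>
  The bounded supersolution \<open>w\<close> makes the Perron family nonempty and its infimum bounded. The
  last clause records the boundary estimate of the minimal solution, with \<open>M\<close> still free so that it can be
  taken to be the maximum of \<open>u\<close>.
\<close>
lemma positive_solution_from_supersolution:
  fixes \<Omega> :: "(real ^ 'n) set"
  assumes "open \<Omega>" "continuous_on \<Omega> a" "\<And>x. x \<in> \<Omega> \<Longrightarrow> a x > 0" and A: "\<And>x. x \<in> \<Omega> \<Longrightarrow> a x \<le> A"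
    and "l > 0" "\<delta> > 0" and w: "visc_supersolution \<Omega> (eigen_rhs a l) w" "\<And>x. x \<in> \<Omega> \<Longrightarrow> \<delta> \<le> w x"
      "\<And>x. x \<in> \<Omega> \<Longrightarrow> w x \<le> M0"
  shows "\<exists>u. positive_solution \<Omega> a l \<delta> u \<and> (\<forall>x\<in>\<Omega>. \<delta> \<le> u x) \<and>
    (\<forall>M r x z. (\<forall>x\<in>\<Omega>. u x \<le> M) \<longrightarrow> z \<notin> \<Omega> \<longrightarrow> 0 < r \<longrightarrow> 64 * l * A * r ^ 4 \<le> 1 \<longrightarrow> x \<in> \<Omega> \<longrightarrow>
       u x \<le> \<delta> + 4 * M / r * dist x z)"
proof -
  interpret perron \<Omega> a l \<delta> using assms by unfold_locales auto
  have "w \<in> fam" using w by (auto simp: fam_def)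
  then have bd: "least x \<le> M0" if "x \<in> \<Omega>" for x
    using least_le[OF _ that] w(3)[OF that] by fastforce
  show ?thesis
    by (rule exI[of _ "\<lambda>x. if x \<in> \<Omega> then least x else \<delta>"])
       (use positive_solution_least[OF bd A] delta_le_least least_boundary_bound[OF _ A] in auto)
qed

text \<open>
  An interior minimum is excluded by a constant test function, as in \<open>delta_less_least\<close> above.
\<close>
lemma positive_solution_ge_boundary:
  assumes "open \<Omega>" "bounded \<Omega>" "l > 0" "\<And>x. x \<in> \<Omega> \<Longrightarrow> a x > 0" "positive_solution \<Omega> a l \<delta> u" "x \<in> \<Omega>"
  shows "\<delta> \<le> u x"
proof -
  have cl: "compact (closure \<Omega>)" "closure \<Omega> \<noteq> {}" using assms(2,6) closure_subset by auto
  have u: "continuous_on (closure \<Omega>) u" "\<And>x. x \<in> \<Omega> \<Longrightarrow> u x > 0"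
    "visc_supersolution \<Omega> (eigen_rhs a l) u" "\<And>x. x \<in> frontier \<Omega> \<Longrightarrow> u x = \<delta>"
    using assms(5) unfolding positive_solution_def visc_solution_def by auto
  obtain q where q: "q \<in> closure \<Omega>" "\<And>x. x \<in> closure \<Omega> \<Longrightarrow> u q \<le> u x"
    using continuous_attains_inf[OF cl u(1)] by blast
  have sub: "\<Omega> \<subseteq> closure \<Omega>" by (rule closure_subset)
  have "q \<notin> \<Omega>"
  proof
    assume q\<Omega>: "q \<in> \<Omega>"
    have "has_local_min_in \<Omega> (\<lambda>y. u y - 0) q"
      unfolding has_local_min_in_def using q q\<Omega> sub by (auto intro!: exI[of _ 1])
    from visc_supersolutionD[OF u(3) C2_on_const this]
    have "0 \<le> - l * a q * u q ^ 3" unfolding inf_laplacian_const .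
    moreover have "0 < l * a q * u q ^ 3" using assms(3) assms(4)[OF q\<Omega>] u(2)[OF q\<Omega>] by simp
    ultimately show False by simp
  qed
  then have "q \<in> frontier \<Omega>" using q(1) assms(1) by (simp add: frontier_def interior_open)
  then show ?thesis using u(4) q(2)[of x] assms(6) sub by auto
qed

lemma positive_solution_attains_max:
  assumes "bounded \<Omega>" "\<Omega> \<noteq> {}" "positive_solution \<Omega> a l \<delta> u"
  obtains p where "p \<in> closure \<Omega>" "\<And>x. x \<in> closure \<Omega> \<Longrightarrow> u x \<le> u p"
proof -
  have "compact (closure \<Omega>)" "closure \<Omega> \<noteq> {}" using assms by auto
  then show ?thesis
    using continuous_attains_sup[of "closure \<Omega>" u] assms(3) that unfolding positive_solution_def by blast
qed

text \<open>
  The inequality behind the blow-up. Since \<open>2u - \<delta> \<le> 2M\<close>, the factor \<open>1 + \<delta>/(2M)\<close> is at most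
  \<open>2u / (2u - \<delta>)\<close>, and lowering \<open>2u\<close> by \<open>\<delta>\<close> leaves its infinity-Laplacian unchanged. The
  factor 2 keeps \<open>2u - \<delta>\<close> above \<open>\<delta>\<close>.
\<close>
lemma solvable_set_gain:
  fixes \<Omega> :: "(real ^ 'n) set"
  assumes \<Omega>: "open \<Omega>" "bounded \<Omega>" "\<Omega> \<noteq> {}" and a: "continuous_on \<Omega> a" "\<And>x. x \<in> \<Omega> \<Longrightarrow> a x > 0"
    "\<And>x. x \<in> \<Omega> \<Longrightarrow> a x \<le> A"
    and l: "l > 0" and \<delta>: "\<delta> > 0" and u: "positive_solution \<Omega> a l \<delta> u" and M: "\<And>x. x \<in> \<Omega> \<Longrightarrow> u x \<le> M"
  shows "l * (1 + \<delta> / (2 * M)) ^ 3 \<in> solvable_set \<Omega> a \<delta>"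
proof -
  define l' where "l' = l * (1 + \<delta> / (2 * M)) ^ 3"
  have ge: "\<delta> \<le> u x" if "x \<in> \<Omega>" for x
    by (rule positive_solution_ge_boundary[OF \<Omega>(1,2) l a(2) u that])
  obtain x0 where "x0 \<in> \<Omega>" using \<Omega>(3) by blast
  then have Mpos: "M > 0" using ge[of x0] M[of x0] \<delta> by simp
  have l': "l' > 0" unfolding l'_def using l \<delta> Mpos by (simp add: add_pos_pos)
  have "visc_supersolution \<Omega> (eigen_rhs a l') (\<lambda>x. 2 * u x + - \<delta>)"
  proof (rule visc_supersolution_affine[OF \<Omega>(1)])
    show "visc_supersolution \<Omega> (eigen_rhs a l) u"
      using u unfolding positive_solution_def visc_solution_def by blast
    fix x assume x: "x \<in> \<Omega>"
    have "\<delta> / (2 * M) * (2 * u x + - \<delta>) \<le> \<delta> / (2 * M) * (2 * M)"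
      using \<delta> Mpos M[OF x] by (intro mult_left_mono) auto
    then have "(1 + \<delta> / (2 * M)) * (2 * u x + - \<delta>) \<le> 2 * u x"
      using Mpos by (simp add: distrib_right)
    moreover have "0 \<le> (1 + \<delta> / (2 * M)) * (2 * u x + - \<delta>)"
      using ge[OF x] \<delta> Mpos by (intro mult_nonneg_nonneg) auto
    ultimately have "((1 + \<delta> / (2 * M)) * (2 * u x + - \<delta>)) ^ 3 \<le> (2 * u x) ^ 3"
      by (intro power_mono)
    then have "l * a x * ((1 + \<delta> / (2 * M)) * (2 * u x + - \<delta>)) ^ 3 \<le> l * a x * (2 * u x) ^ 3"
      using l a(2)[OF x] by (intro mult_left_mono) auto
    then show "l' * a x * (2 * u x + - \<delta>) ^ 3 \<le> l * a x * (2 * u x) ^ 3"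
      unfolding l'_def power_mult_distrib by (simp only: mult_ac)
  qed simp
  moreover have "\<delta> \<le> 2 * u x + - \<delta>" "2 * u x + - \<delta> \<le> 2 * M" if "x \<in> \<Omega>" for x
    using ge[OF that] M[OF that] \<delta> by auto
  ultimately have "\<exists>v. positive_solution \<Omega> a l' \<delta> v"
    using positive_solution_from_supersolution[OF \<Omega>(1) a(1,2) a(3) l' \<delta>, of "\<lambda>x. 2 * u x + - \<delta>" "2 * M"] by blast
  then show ?thesis using l' unfolding solvable_set_def l'_def[symmetric] by auto
qed

text \<open>
  The paraboloid \<open>C - \<bar>x - y\<bar>\<^sup>2\<close> has infinity-Laplacian \<open>-8 \<bar>x - y\<bar>\<^sup>2\<close>, which is at most \<open>-8\<close> when the vertex \<open>y\<close> has
  distance at least 1 from \<open>\<Omega>\<close>.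
\<close>
lemma solvable_set_has_positive:
  fixes \<Omega> :: "(real ^ 'n) set"
  assumes \<Omega>: "open \<Omega>" "bounded \<Omega>" and a: "continuous_on \<Omega> a" "\<And>x. x \<in> \<Omega> \<Longrightarrow> a x > 0"
    "\<And>x. x \<in> \<Omega> \<Longrightarrow> a x \<le> A" and A: "A > 0" and \<delta>: "\<delta> > 0"
  shows "\<exists>l>0. l \<in> solvable_set \<Omega> a \<delta>"
proof -
  obtain B where B: "B > 0" "\<And>x. x \<in> \<Omega> \<Longrightarrow> norm x \<le> B" using \<Omega>(2) bounded_pos by blast
  obtain y :: "real ^ 'n" where ny: "norm y = B + 1"
    using vector_choose_size[of "B + 1"] B(1) by auto
  have d: "1 \<le> norm (x - y)" "norm (x - y) \<le> 2 * B + 1" if "x \<in> \<Omega>" for x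
  proof -
    show "1 \<le> norm (x - y)" using norm_triangle_ineq2[of y x] B(2)[OF that] ny by (simp add: norm_minus_commute)
    show "norm (x - y) \<le> 2 * B + 1" using norm_triangle_ineq4[of x y] B(2)[OF that] ny by simp
  qed
  define s where "s = (\<lambda>x. (x - y) \<bullet> (x - y))"
  have s: "1 \<le> s x" "s x \<le> (2 * B + 1)\<^sup>2" if "x \<in> \<Omega>" for x
    using d[OF that] power_mono[of 1 "norm (x - y)" 2] power_mono[of "norm (x - y)" "2 * B + 1" 2]
    unfolding s_def power2_norm_eq_inner[symmetric] by auto
  define C where "C = (2 * B + 1)\<^sup>2 + \<delta>"
  have C: "C > 0" using \<delta> by (simp add: C_def add_nonneg_pos)
  define l where "l = 8 / (A * C ^ 3)"
  have l: "l > 0" using A C by (simp add: l_def)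
  define w where "w = (\<lambda>x. C - s x)"
  note rad = inf_laplacian_radial[where h = "\<lambda>s. C - s" and h' = "\<lambda>s. -1" and h'' = "\<lambda>s. 0" and y = y, OF \<Omega>(1)]
  have C2: "C2_on \<Omega> w" unfolding w_def s_def
    by (rule rad(1)) (auto intro!: derivative_eq_intros)
  have lap: "inf_laplacian w x = - 8 * s x" if "x \<in> \<Omega>" for x
    unfolding w_def s_def by (subst rad(2)) (auto intro!: derivative_eq_intros that)
  have w: "\<delta> \<le> w x" "w x \<le> C" if "x \<in> \<Omega>" for x
    using s[OF that] by (auto simp: w_def C_def)
  have "visc_supersolution \<Omega> (eigen_rhs a l) w"
  proof (rule classical_imp_visc_supersolution[OF \<Omega>(1) C2])
    fix x assume x: "x \<in> \<Omega>"
    have "w x ^ 3 \<le> C ^ 3" using w[OF x] \<delta> by (intro power_mono) auto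
    then have "a x * w x ^ 3 \<le> A * C ^ 3"
      using a(2)[OF x] a(3)[OF x] w[OF x] \<delta> by (intro mult_mono) auto
    then have "l * (a x * w x ^ 3) \<le> l * (A * C ^ 3)" using l by (intro mult_left_mono) auto
    also have "l * (A * C ^ 3) = 8" using A C by (simp add: l_def)
    finally show "inf_laplacian w x \<le> - l * a x * w x ^ 3"
      unfolding lap[OF x] using s[OF x] by simp
  qed
  then have "\<exists>v. positive_solution \<Omega> a l \<delta> v"
    using positive_solution_from_supersolution[OF \<Omega>(1) a l \<delta>, of w C] w by blast
  then show ?thesis using l unfolding solvable_set_def by (intro exI[of _ l]) auto
qed

lemma solvable_set_bdd_above:
  fixes \<Omega> :: "(real ^ 'n) set"
  assumes \<Omega>: "open \<Omega>" "\<Omega> \<noteq> {}" and a: "continuous_on \<Omega> a" "\<And>x. x \<in> \<Omega> \<Longrightarrow> a x > 0"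
  shows "bdd_above (solvable_set \<Omega> a \<delta>)"
proof -
  obtain y R where R: "R > 0" "cball y R \<subseteq> \<Omega>" using \<Omega> open_contains_cball by blast
  have "continuous_on (cball y R) a" using a(1) R(2) by (rule continuous_on_subset)
  then obtain q where q: "q \<in> cball y R" "\<And>x. x \<in> cball y R \<Longrightarrow> a q \<le> a x"
    using continuous_attains_inf[OF compact_cball, of y R a] R by force
  have aq: "a q > 0" using a(2) q R by blast
  show ?thesis
  proof (rule bdd_aboveI)
    fix l assume "l \<in> solvable_set \<Omega> a \<delta>"
    then obtain u where l: "l \<ge> 0" and u: "positive_solution \<Omega> a l \<delta> u"
      unfolding solvable_set_def by blast
    have "l * a q * R ^ 4 \<le> 108"
      using u q(2) unfolding positive_solution_def visc_solution_def
      by (intro eigenvalue_upper_bound[OF \<Omega>(1) _ _ R _ l]) auto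
    then show "l \<le> 108 / (a q * R ^ 4)"
      using aq R(1) by (simp add: pos_le_divide_eq mult.assoc)
  qed
qed

section \<open>The eigenfunction as a limit of normalised solutions\<close>

lemma visc_solution_scale:
  assumes "open \<Omega>" "t > 0" "visc_solution \<Omega> (eigen_rhs a l) u"
  shows "visc_solution \<Omega> (eigen_rhs a l) (\<lambda>x. t * u x)"
proof -
  have "visc_supersolution \<Omega> (eigen_rhs a l) (\<lambda>x. t * u x + 0)"
    using assms by (intro visc_supersolution_affine[where l = l]) (auto simp: visc_solution_def)
  moreover have "visc_supersolution \<Omega> (eigen_rhs a l) (\<lambda>x. t * - u x + 0)"
    using assms visc_subsolution_uminus_iff[OF assms(1), where a = a and l = l and u = u]
    by (intro visc_supersolution_affine[where l = l]) (auto simp: visc_solution_def)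
  ultimately show ?thesis
    unfolding visc_solution_def visc_subsolution_uminus_iff[OF assms(1)] by simp
qed

lemma visc_solution_uniform_limit:
  assumes \<Omega>: "open \<Omega>" and a: "continuous_on \<Omega> a" and g: "continuous_on \<Omega> g"
    and v: "\<And>n::nat. visc_solution \<Omega> (eigen_rhs a (l n)) (v n)" and l: "l \<longlonglongrightarrow> \<Lambda>"
    and lim: "\<And>e. e > 0 \<Longrightarrow> \<exists>N. \<forall>n\<ge>N. \<forall>x\<in>\<Omega>. \<bar>v n x - g x\<bar> < e"
  shows "visc_solution \<Omega> (eigen_rhs a \<Lambda>) g"
proof -
  have close: "\<exists>n. \<bar>l n - \<Lambda>\<bar> \<le> e \<and> (\<forall>x\<in>\<Omega>. \<bar>v n x - g x\<bar> \<le> e)" if e: "e > 0" for e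
  proof -
    obtain N where N: "\<forall>n\<ge>N. \<forall>x\<in>\<Omega>. \<bar>v n x - g x\<bar> < e" using lim[OF e] by blast
    obtain N' where N': "\<forall>n\<ge>N'. \<bar>l n - \<Lambda>\<bar> < e" using LIMSEQ_D[OF l e] by auto
    show ?thesis
      using N N' by (intro exI[of _ "max N N'"]) (auto intro: less_imp_le)
  qed
  have "visc_supersolution \<Omega> (eigen_rhs a \<Lambda>) g"
  proof (rule visc_supersolution_limit[OF \<Omega> a g])
    fix q and e :: real assume q: "q \<in> \<Omega>" and e: "e > 0"
    obtain n where n: "\<bar>l n - \<Lambda>\<bar> \<le> e" "\<And>x. x \<in> \<Omega> \<Longrightarrow> \<bar>v n x - g x\<bar> \<le> e" using close[OF e] by blast
    show "\<exists>l' w. \<bar>l' - \<Lambda>\<bar> \<le> e \<and> visc_supersolution \<Omega> (eigen_rhs a l') w \<and> w q \<le> g q + e \<and> (\<forall>x\<in>\<Omega>. g x - e \<le> w x)"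
    proof (intro exI conjI ballI)
      show "\<bar>l n - \<Lambda>\<bar> \<le> e" by (rule n)
      show "visc_supersolution \<Omega> (eigen_rhs a (l n)) (v n)" using v by (simp only: visc_solution_def)
      show "v n q \<le> g q + e" using n(2)[OF q] by linarith
      show "g x - e \<le> v n x" if "x \<in> \<Omega>" for x using n(2)[OF that] by linarith
    qed
  qed
  moreover have "visc_supersolution \<Omega> (eigen_rhs a \<Lambda>) (\<lambda>x. - g x)"
  proof (rule visc_supersolution_limit[OF \<Omega> a])
    show "continuous_on \<Omega> (\<lambda>x. - g x)" by (intro continuous_intros g)
    fix q and e :: real assume q: "q \<in> \<Omega>" and e: "e > 0"
    obtain n where n: "\<bar>l n - \<Lambda>\<bar> \<le> e" "\<And>x. x \<in> \<Omega> \<Longrightarrow> \<bar>v n x - g x\<bar> \<le> e" using close[OF e] by blast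
    show "\<exists>l' w. \<bar>l' - \<Lambda>\<bar> \<le> e \<and> visc_supersolution \<Omega> (eigen_rhs a l') w \<and> w q \<le> - g q + e \<and> (\<forall>x\<in>\<Omega>. - g x - e \<le> w x)"
    proof (intro exI conjI ballI)
      show "\<bar>l n - \<Lambda>\<bar> \<le> e" by (rule n)
      show "visc_supersolution \<Omega> (eigen_rhs a (l n)) (\<lambda>x. - v n x)"
        using v[of n] visc_subsolution_uminus_iff[OF \<Omega>] by (simp only: visc_solution_def)
      show "- v n q \<le> - g q + e" using n(2)[OF q] by linarith
      show "- g x - e \<le> - v n x" if "x \<in> \<Omega>" for x using n(2)[OF that] by linarith
    qed
  qed
  ultimately show ?thesis unfolding visc_solution_def visc_subsolution_uminus_iff[OF \<Omega>] by blast
qed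

theorem theorem4p1:
  fixes \<Omega> :: "(real ^ 'n) set" and a :: "real ^ 'n \<Rightarrow> real" and \<delta> :: real
  assumes "CARD('n) \<ge> 2"
    and "bounded_domain \<Omega>"
    and "continuous_on \<Omega> a"
    and "L_infinity_on \<Omega> a"
    and "\<forall>x\<in>\<Omega>. a x > 0"
    and "\<delta> > 0"
  shows "\<exists>v. positive_solution \<Omega> a (lambda_sup \<Omega> a \<delta>) 0 v"
proof -
  have \<Omega>: "open \<Omega>" "connected \<Omega>" "\<Omega> \<noteq> {}" "bounded \<Omega>"
    using assms(2) unfolding bounded_domain_def by auto
  have a: "\<And>x. x \<in> \<Omega> \<Longrightarrow> a x > 0" using assms(5) by blast
  obtain A where A: "A > 0" "\<And>x. x \<in> \<Omega> \<Longrightarrow> a x \<le> A"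
    using L_infinity_on_continuous_bound[OF \<Omega>(1) assms(3,4)] by blast
  define S where "S = solvable_set \<Omega> a \<delta>"
  define \<Lambda> where "\<Lambda> = lambda_sup \<Omega> a \<delta>"
  have \<Lambda>S: "\<Lambda> = Sup S" by (simp add: \<Lambda>_def S_def lambda_sup_def)
  have bdd: "bdd_above S" unfolding S_def by (rule solvable_set_bdd_above[OF \<Omega>(1,3) assms(3) a])
  have le\<Lambda>: "l \<le> \<Lambda>" if "l \<in> S" for l unfolding \<Lambda>S by (rule cSup_upper[OF that bdd])
  obtain l0 where l0: "l0 > 0" "l0 \<in> S"
    using solvable_set_has_positive[OF \<Omega>(1,4) assms(3) a A(2,1) assms(6)] unfolding S_def by blast
  have \<Lambda>: "\<Lambda> > 0" using le\<Lambda>[OF l0(2)] l0 by simp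
  have frontier_notin: "x \<notin> \<Omega>" if "x \<in> frontier \<Omega>" for x
    using that \<Omega>(1) by (auto simp: frontier_def interior_open)
  have closure_cases: "x \<in> \<Omega> \<or> x \<in> frontier \<Omega>" if "x \<in> closure \<Omega>" for x
    using that \<Omega>(1) by (auto simp: frontier_def interior_open)
  have sub: "\<Omega> \<subseteq> closure \<Omega>" by (rule closure_subset)

  \<comment> \<open>Solvable parameters approaching \<open>\<Lambda>\<close>, each with its minimal solution.\<close>
  have "\<exists>l u. l \<in> S \<and> l > 0 \<and> \<Lambda> - inverse (real (Suc n)) < l \<and>
      positive_solution \<Omega> a l \<delta> u \<and> (\<forall>x\<in>\<Omega>. \<delta> \<le> u x) \<and>
      (\<forall>M r x z. (\<forall>x\<in>\<Omega>. u x \<le> M) \<longrightarrow> z \<notin> \<Omega> \<longrightarrow> 0 < r \<longrightarrow> 64 * l * A * r ^ 4 \<le> 1 \<longrightarrow> x \<in> \<Omega> \<longrightarrow>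
         u x \<le> \<delta> + 4 * M / r * dist x z)" for n
  proof -
    have "max 0 (\<Lambda> - inverse (real (Suc n))) < Sup S" using \<Lambda> by (simp add: \<Lambda>S[symmetric])
    then obtain l where l: "l \<in> S" "max 0 (\<Lambda> - inverse (real (Suc n))) < l"
      using less_cSupE l0(2) by blast
    then have lpos: "l > 0" by simp
    obtain w where w: "positive_solution \<Omega> a l \<delta> w" using l(1) unfolding S_def solvable_set_def by blast
    obtain p where p: "p \<in> closure \<Omega>" "\<And>x. x \<in> closure \<Omega> \<Longrightarrow> w x \<le> w p"
      using positive_solution_attains_max[OF \<Omega>(4,3) w] by blast
    have ws: "visc_supersolution \<Omega> (eigen_rhs a l) w"
      using w unfolding positive_solution_def visc_solution_def by blast
    have "w x \<le> w p" if "x \<in> \<Omega>" for x using p(2) that sub by blast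
    from positive_solution_from_supersolution[OF \<Omega>(1) assms(3) a A(2) lpos assms(6) ws
        positive_solution_ge_boundary[OF \<Omega>(1,4) lpos a w] this]
    show ?thesis using l lpos by (intro exI[of _ l]) auto
  qed
  then obtain l u where l: "\<And>n. l n \<in> S" "\<And>n. l n > 0" "\<And>n. \<Lambda> - inverse (real (Suc n)) < l n"
    and u: "\<And>n. positive_solution \<Omega> a (l n) \<delta> (u n)" "\<And>n x. x \<in> \<Omega> \<Longrightarrow> \<delta> \<le> u n x"
    and ub: "\<And>n M r x z. (\<forall>x\<in>\<Omega>. u n x \<le> M) \<Longrightarrow> z \<notin> \<Omega> \<Longrightarrow> 0 < r \<Longrightarrow> 64 * l n * A * r ^ 4 \<le> 1 \<Longrightarrow> x \<in> \<Omega> \<Longrightarrow>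
         u n x \<le> \<delta> + 4 * M / r * dist x z"
    by metis
  have l_lim: "l \<longlonglongrightarrow> \<Lambda>"
  proof (rule tendsto_sandwich[OF _ _ _ tendsto_const])
    show "\<forall>\<^sub>F n in sequentially. \<Lambda> - inverse (real (Suc n)) \<le> l n" using l(3) by (simp add: less_imp_le)
    show "\<forall>\<^sub>F n in sequentially. l n \<le> \<Lambda>" using le\<Lambda>[OF l(1)] by simp
    show "(\<lambda>n. \<Lambda> - inverse (real (Suc n))) \<longlonglongrightarrow> \<Lambda>"
      using tendsto_diff[OF tendsto_const LIMSEQ_inverse_real_of_nat, of \<Lambda>] by simp
  qed
  have "\<exists>p. p \<in> closure \<Omega> \<and> (\<forall>x\<in>closure \<Omega>. u n x \<le> u n p)" for n
    using positive_solution_attains_max[OF \<Omega>(4,3) u(1)] by metis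
  then obtain p where p: "\<And>n. p n \<in> closure \<Omega>" "\<And>n x. x \<in> closure \<Omega> \<Longrightarrow> u n x \<le> u n (p n)" by metis
  define M where "M = (\<lambda>n. u n (p n))"
  have uM: "u n x \<le> M n" if "x \<in> closure \<Omega>" for n x using p(2)[OF that] by (simp add: M_def)
  obtain x0 where x0: "x0 \<in> \<Omega>" using \<Omega>(3) by blast
  have M\<delta>: "\<delta> \<le> M n" for n using u(2)[OF x0] uM[of x0 n] x0 sub by (meson order_trans subsetD)
  have Mpos: "M n > 0" for n using M\<delta>[of n] assms(6) by simp
  have gain: "l n * (1 + \<delta> / (2 * M n)) ^ 3 \<le> \<Lambda>" for n
    using le\<Lambda>[unfolded S_def] solvable_set_gain[OF \<Omega>(1,4,3) assms(3) a A(2) l(2) assms(6) u(1), of n "M n"] uM sub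
    by blast
  define b where "b = (\<lambda>n. \<delta> / M n)"
  have b_pos: "b n > 0" for n using Mpos assms(6) by (simp add: b_def)
  \<comment> \<open>The boundary values \<open>b n\<close> of the normalised solutions tend to 0, as \<open>\<Lambda>\<close> cannot be exceeded.\<close>
  have b_le: "b n \<le> 2 * (\<Lambda> / l n - 1)" for n
  proof -
    have "1 + b n / 2 \<le> (1 + b n / 2) ^ 3" using b_pos[of n] by (intro self_le_power) auto
    also have "\<dots> \<le> \<Lambda> / l n" using gain[of n] l(2)[of n] by (simp add: b_def pos_le_divide_eq mult.commute)
    finally show ?thesis by simp
  qed
  have b_lim: "b \<longlonglongrightarrow> 0"
  proof (rule tendsto_sandwich[OF _ _ tendsto_const])
    have "(\<lambda>n. 2 * (\<Lambda> / l n - 1)) \<longlonglongrightarrow> 2 * (\<Lambda> / \<Lambda> - 1)"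
      using \<Lambda> by (intro tendsto_intros l_lim) auto
    then show "(\<lambda>n. 2 * (\<Lambda> / l n - 1)) \<longlonglongrightarrow> 0" using \<Lambda> by simp
  qed (use b_le b_pos in \<open>simp_all add: less_imp_le\<close>)
  define v where "v = (\<lambda>n x. (1 / M n) * u n x)"
  have v01: "0 \<le> v n x" "v n x \<le> 1" if "x \<in> closure \<Omega>" for n x
  proof -
    have "u n x \<ge> 0"
      using closure_cases[OF that] u(2)[of x n] assms(6) u(1)[of n] unfolding positive_solution_def by force
    then show "0 \<le> v n x" using Mpos[of n] by (simp add: v_def)
    show "v n x \<le> 1" using uM[OF that, of n] Mpos[of n] by (simp add: v_def)
  qed
  have vb: "v n x = b n" if "x \<in> frontier \<Omega>" for n x
    using u(1)[of n] that unfolding positive_solution_def by (simp add: v_def b_def)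
  have v_sol: "visc_solution \<Omega> (eigen_rhs a (l n)) (v n)" for n
    unfolding v_def using u(1)[of n] Mpos[of n] unfolding positive_solution_def
    by (intro visc_solution_scale[OF \<Omega>(1)]) auto
  have v_cones: "above_cones \<Omega> (v n)" for n
    using v_sol[of n] l(2)[of n] a v01(1) sub unfolding visc_solution_def
    by (intro visc_supersolution_above_cones[OF \<Omega>(1), where l = "l n" and a = a]) (auto intro: less_imp_le)
  \<comment> \<open>One barrier radius for all \<open>n\<close>; since \<open>r \<le> 1\<close>, the bound on \<open>r\<close> implies that on \<open>r ^ 4\<close>.\<close>
  define r where "r = min 1 (1 / (64 * \<Lambda> * A))"
  have r: "r > 0" "64 * \<Lambda> * A * r ^ 4 \<le> 1"
  proof -
    show r0: "r > 0" using \<Lambda> A by (simp add: r_def)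
    have "r ^ 4 \<le> r ^ 1" using r0 by (intro power_decreasing) (auto simp: r_def)
    also have "\<dots> \<le> 1 / (64 * \<Lambda> * A)" by (simp add: r_def)
    finally show "64 * \<Lambda> * A * r ^ 4 \<le> 1" using \<Lambda> A by (simp add: field_simps)
  qed
  have v_bdry: "v n x \<le> b n + 4 / r * dist x z" if "x \<in> \<Omega>" "z \<notin> \<Omega>" for n x z
  proof -
    have "64 * l n * A * r ^ 4 \<le> 64 * \<Lambda> * A * r ^ 4"
      using le\<Lambda>[OF l(1)] A r by (intro mult_right_mono mult_left_mono) auto
    then have "64 * l n * A * r ^ 4 \<le> 1" using r(2) by linarith
    then have "u n x \<le> \<delta> + 4 * M n / r * dist x z"
      using uM sub that r(1) by (intro ub) auto
    then have "(1 / M n) * u n x \<le> (1 / M n) * (\<delta> + 4 * M n / r * dist x z)"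
      using Mpos[of n] by (intro mult_left_mono) auto
    also have "\<dots> = b n + 4 / r * dist x z" using Mpos[of n] by (simp add: b_def field_simps)
    finally show ?thesis by (simp add: v_def)
  qed
  have v_lower: "b n \<le> v n x" if "x \<in> \<Omega>" for n x
    using u(2)[OF that, of n] Mpos[of n] by (simp add: v_def b_def divide_right_mono)

  \<comment> \<open>Equicontinuity: from the cones at interior points, from the barrier at boundary points.\<close>
  obtain g k where g: "continuous_on (closure \<Omega>) g" and k: "strict_mono (k :: nat \<Rightarrow> nat)"
    and lim: "\<And>e. 0 < e \<Longrightarrow> \<exists>N. \<forall>n x. n \<ge> N \<and> x \<in> closure \<Omega> \<longrightarrow> norm (v (k n) x - g x) < e"
  proof (rule Arzela_Ascoli[of "closure \<Omega>" v 1])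
    show "compact (closure \<Omega>)" using \<Omega>(4) by simp
    show "norm (v n x) \<le> 1" if "x \<in> closure \<Omega>" for n x using v01[OF that, of n] by simp
    fix x and e :: real assume x: "x \<in> closure \<Omega>" and e: "0 < e"
    show "\<exists>d>0. \<forall>n y. y \<in> closure \<Omega> \<and> norm (x - y) < d \<longrightarrow> norm (v n x - v n y) < e"
    proof (cases "x \<in> \<Omega>")
      case True
      then obtain R0 where R0: "R0 > 0" "cball x R0 \<subseteq> \<Omega>" using \<Omega>(1) open_contains_cball by blast
      define R where "R = R0 / 2"
      have R: "R > 0" "cball x (2 * R) \<subseteq> \<Omega>" using R0 by (auto simp: R_def)
      show ?thesis
      proof (intro exI[of _ "min (R / 2) (e * R / 2)"] conjI allI impI)
        show "0 < min (R / 2) (e * R / 2)" using R e by simp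
        fix n y assume y: "y \<in> closure \<Omega> \<and> norm (x - y) < min (R / 2) (e * R / 2)"
        then have d: "dist y x \<le> R / 2" "dist y x < e * R / 2" by (auto simp: dist_norm norm_minus_commute)
        have "\<bar>v n y - v n x\<bar> \<le> 2 * v n x * dist y x / R"
          by (rule above_cones_diff[OF v_cones R d(1)])
        also have "\<dots> \<le> 2 * 1 * dist y x / R"
          using v01(2)[OF x, of n] R by (intro divide_right_mono mult_right_mono) auto
        also have "\<dots> < e" using d(2) R by (simp add: field_simps)
        finally show "norm (v n x - v n y) < e" by (simp add: abs_minus_commute)
      qed
    next
      case False
      then have xf: "x \<in> frontier \<Omega>" using closure_cases[OF x] by blast
      show ?thesis
      proof (intro exI[of _ "e * r / 4"] conjI allI impI)
        show "0 < e * r / 4" using e r by simp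
        fix n y assume y: "y \<in> closure \<Omega> \<and> norm (x - y) < e * r / 4"
        show "norm (v n x - v n y) < e"
        proof (cases "y \<in> \<Omega>")
          case True
          have "4 / r * dist y x < e" using y r by (simp add: dist_norm norm_minus_commute field_simps)
          then show ?thesis using v_bdry[OF True False, of n] v_lower[OF True, of n] vb[OF xf, of n] by simp
        next
          case False
          then have "y \<in> frontier \<Omega>" using closure_cases y by blast
          then show ?thesis using vb xf e by simp
        qed
      qed
    qed
  qed (rule that)
  have pointwise: "(\<lambda>n. v (k n) x) \<longlonglongrightarrow> g x" if "x \<in> closure \<Omega>" for x
    using lim that by (intro LIMSEQ_I) blast
  have g_nonneg: "0 \<le> g x" if "x \<in> closure \<Omega>" for x
    by (rule LIMSEQ_le_const[OF pointwise[OF that]]) (use v01[OF that] in auto)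
  have g_frontier: "g x = 0" if "x \<in> frontier \<Omega>" for x
  proof -
    have "x \<in> closure \<Omega>" using that by (simp add: frontier_def)
    from pointwise[OF this] have "(\<lambda>n. b (k n)) \<longlonglongrightarrow> g x" unfolding vb[OF that] .
    moreover have "(\<lambda>n. b (k n)) \<longlonglongrightarrow> 0"
      using LIMSEQ_subseq_LIMSEQ[OF b_lim k] by (simp add: o_def)
    ultimately show ?thesis by (rule LIMSEQ_unique)
  qed
  have cg: "continuous_on \<Omega> g" using g sub by (rule continuous_on_subset)
  have g_sol: "visc_solution \<Omega> (eigen_rhs a \<Lambda>) g"
  proof (rule visc_solution_uniform_limit[OF \<Omega>(1) assms(3) cg v_sol])
    show "(\<lambda>n. l (k n)) \<longlonglongrightarrow> \<Lambda>" using LIMSEQ_subseq_LIMSEQ[OF l_lim k] by (simp add: o_def)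
    show "\<exists>N. \<forall>n\<ge>N. \<forall>x\<in>\<Omega>. \<bar>v (k n) x - g x\<bar> < e" if "e > 0" for e
      using lim[OF that] sub by (metis real_norm_def subsetD)
  qed
  have g_cones: "above_cones \<Omega> g"
    using g_sol \<Lambda> a g_nonneg sub unfolding visc_solution_def
    by (intro visc_supersolution_above_cones[OF \<Omega>(1), where l = \<Lambda> and a = a]) (auto intro: less_imp_le)
  \<comment> \<open>The maximum 1 is not lost in the limit, and it cannot be lost to the boundary, where \<open>g\<close> vanishes.\<close>
  have "\<exists>q\<in>\<Omega>. g q > 0"
  proof -
    obtain N where N: "\<And>n x. n \<ge> N \<Longrightarrow> x \<in> closure \<Omega> \<Longrightarrow> norm (v (k n) x - g x) < 1 / 2"
      using lim[of "1 / 2"] by auto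
    define q where "q = p (k N)"
    have q: "q \<in> closure \<Omega>" using p(1) by (simp add: q_def)
    have "v (k N) q = 1" using Mpos[of "k N"] by (simp add: v_def q_def M_def)
    then have "g q > 0" using N[OF order_refl q] unfolding real_norm_def by linarith
    then show ?thesis using closure_cases[OF q] g_frontier by force
  qed
  then obtain q where q: "q \<in> \<Omega>" "g q > 0" by blast
  have g_pos: "g x > 0" if "x \<in> \<Omega>" for x
    by (rule above_cones_strictly_positive[OF \<Omega>(1,2) g_cones q that])
  have "positive_solution \<Omega> a \<Lambda> 0 g"
    unfolding positive_solution_def using g g_pos g_sol g_frontier by blast
  then show ?thesis unfolding \<Lambda>_def by blast
qed

end
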